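(* Let $K$ and $L$ be locally compact Hausdorff spaces and let $X$ be a real Banach space containing no isomorphic copy of $c_0$. Assume that either $X$ is separable or $X^*$ has the Radon–Nikodým property. If there exists an isomorphic embedding of $C_0(K)$ into $C_0(L,X)$, then either $K$ is finite or $|K|\leq |L|$.
   Context: For a locally compact Hausdorff space $K$ and a real Banach space $X$, $C_0(K,X)$ denotes the Banach space of all continuous functions $f:K\to X$ vanishing at infinity, with the norm $\|f\|=\sup_{x\in K}\|f(x)\|$; $C_0(K)=C_0(K,\mathbb{R})$, and $c_0=C_0(\mathbb{N})$. A linear operator $T:X\to Y$ between Banach spaces is an isomorphic embedding if there are $A,B>0$ with $A\|u\|\le\|Tu\|\le B\|u\|$ for all $u\in X$; "$Y$ contains a copy of $X$" means such an embedding exists. $|\Gamma|$ denotes the cardinality of a set $\Gamma$. *)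

theory Defs
  imports "HOL-Analysis.Analysis"
begin

definition vanishes_at_infinity :: "('a::topological_space \<Rightarrow> 'b::real_normed_vector) \<Rightarrow> bool" where
  "vanishes_at_infinity f \<longleftrightarrow>
     (\<forall>e>0. \<exists>C. compact C \<and> (\<forall>x. x \<notin> C \<longrightarrow> norm (f x) < e))"

definition C0 :: "('a::topological_space \<Rightarrow> 'b::real_normed_vector) set" where
  "C0 = {f. continuous_on UNIV f \<and> vanishes_at_infinity f}"

definition supnorm :: "('a \<Rightarrow> 'b::real_normed_vector) \<Rightarrow> real" where
  "supnorm f = (SUP x. norm (f x))"

abbreviation c0 :: "(nat \<Rightarrow> real) set" where
  "c0 \<equiv> C0"

definition iso_embedding_into_space ::
  "('a \<Rightarrow> 'v::real_normed_vector) set \<Rightarrow> (('a \<Rightarrow> 'v) \<Rightarrow> 'w::real_normed_vector) \<Rightarrow> bool" where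
  "iso_embedding_into_space S T \<longleftrightarrow>
     (\<forall>f\<in>S. \<forall>g\<in>S. T (\<lambda>x. f x + g x) = T f + T g) \<and>
     (\<forall>c. \<forall>f\<in>S. T (\<lambda>x. c *\<^sub>R f x) = c *\<^sub>R T f) \<and>
     (\<exists>A B. A > 0 \<and> B > 0 \<and>
        (\<forall>f\<in>S. A * supnorm f \<le> norm (T f) \<and> norm (T f) \<le> B * supnorm f))"

definition iso_embedding_into_fun_space ::
  "('a \<Rightarrow> 'v::real_normed_vector) set \<Rightarrow> ('c \<Rightarrow> 'w::real_normed_vector) set
     \<Rightarrow> (('a \<Rightarrow> 'v) \<Rightarrow> ('c \<Rightarrow> 'w)) \<Rightarrow> bool" where
  "iso_embedding_into_fun_space S U T \<longleftrightarrow>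
     (\<forall>f\<in>S. T f \<in> U) \<and>
     (\<forall>f\<in>S. \<forall>g\<in>S. T (\<lambda>x. f x + g x) = (\<lambda>y. T f y + T g y)) \<and>
     (\<forall>c. \<forall>f\<in>S. T (\<lambda>x. c *\<^sub>R f x) = (\<lambda>y. c *\<^sub>R T f y)) \<and>
     (\<exists>A B. A > 0 \<and> B > 0 \<and>
        (\<forall>f\<in>S. A * supnorm f \<le> supnorm (T f) \<and> supnorm (T f) \<le> B * supnorm f))"

definition contains_copy_of_c0 :: "'x::real_normed_vector itself \<Rightarrow> bool" where
  "contains_copy_of_c0 _ \<longleftrightarrow> (\<exists>T :: (nat \<Rightarrow> real) \<Rightarrow> 'x. iso_embedding_into_space c0 T)"

definition countably_additive_vm :: "'o measure \<Rightarrow> ('o set \<Rightarrow> 'b::real_normed_vector) \<Rightarrow> bool" where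
  "countably_additive_vm M \<nu> \<longleftrightarrow>
     (\<forall>A :: nat \<Rightarrow> 'o set. range A \<subseteq> sets M \<and> disjoint_family A \<longrightarrow>
        (\<lambda>n. \<nu> (A n)) sums \<nu> (\<Union>n. A n))"

definition bounded_variation_vm :: "'o measure \<Rightarrow> ('o set \<Rightarrow> 'b::real_normed_vector) \<Rightarrow> bool" where
  "bounded_variation_vm M \<nu> \<longleftrightarrow>
     (\<exists>B. \<forall>P. finite P \<and> P \<subseteq> sets M \<and> disjoint P \<longrightarrow> (\<Sum>E\<in>P. norm (\<nu> E)) \<le> B)"

definition abs_continuous_vm :: "'o measure \<Rightarrow> ('o set \<Rightarrow> 'b::real_normed_vector) \<Rightarrow> bool" where
  "abs_continuous_vm M \<nu> \<longleftrightarrow> (\<forall>E\<in>sets M. emeasure M E = 0 \<longrightarrow> \<nu> E = 0)"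

text \<open>Bochner integrability, defined directly (HOL-Analysis's Bochner integral requires a
  second countable codomain, which a dual space need not be): f is Bochner integrable
  with indefinite integral \<nu> if there are simple functions
  s n = (\<Sum>i<k n. indicator (A n i) *R v n i) converging to f almost everywhere with
  \<integral>\<parallel>s n - f\<parallel> \<rightarrow> 0, and \<nu> E is the limit of the integrals over E of the s n.\<close>

definition bochner_indefinite_integral ::
  "'o measure \<Rightarrow> ('o \<Rightarrow> 'b::real_normed_vector) \<Rightarrow> ('o set \<Rightarrow> 'b) \<Rightarrow> bool" where
  "bochner_indefinite_integral M f \<nu> \<longleftrightarrow>
     (\<exists>(k :: nat \<Rightarrow> nat) (A :: nat \<Rightarrow> nat \<Rightarrow> 'o set) (v :: nat \<Rightarrow> nat \<Rightarrow> 'b).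
        (\<forall>n i. A n i \<in> sets M \<and> emeasure M (A n i) < \<infinity>) \<and>
        (AE x in M. (\<lambda>n. \<Sum>i<k n. indicator (A n i) x *\<^sub>R v n i) \<longlonglongrightarrow> f x) \<and>
        (\<lambda>n. \<integral>\<^sup>+ x. ennreal (norm ((\<Sum>i<k n. indicator (A n i) x *\<^sub>R v n i) - f x)) \<partial>M)
           \<longlonglongrightarrow> 0 \<and>
        (\<forall>E\<in>sets M. (\<lambda>n. \<Sum>i<k n. measure M (A n i \<inter> E) *\<^sub>R v n i) \<longlonglongrightarrow> \<nu> E))"

definition RNP :: "'b::banach itself \<Rightarrow> bool" where
  "RNP _ \<longleftrightarrow>
     (\<forall>(M :: real measure) (\<nu> :: real set \<Rightarrow> 'b).
        finite_measure M \<and> countably_additive_vm M \<nu> \<and> bounded_variation_vm M \<nu> \<and>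
        abs_continuous_vm M \<nu> \<longrightarrow>
        (\<exists>f. bochner_indefinite_integral M f \<nu>))"

end

(* Let x be a point of K and call x charged by y in L if the operator f |-> T f y, viewed as a vector
   measure on K, has positive semivariation at {x}. Since X contains no copy of c_0, T d_n y tends
   to 0 whenever the sums of the |d_n| are bounded by 1, so each y charges only countably many x.

   Conversely every x is charged. The Hahn-Banach theorem gives a positive functional J on C_b(L)
   with J(norm(T f)) >= A whenever f x = 1. Suppose that no y charges x. For each functional phi
   of norm at most 1, a maximality argument for J of finite maxima of functions phi(T f), with f in
   the unit ball vanishing near x, produces a neighbourhood U of x such that J(|phi(T f)|) is small
   for all f in the unit ball supported in U: a function phi(T f) outside the maximum would add to it.
   As T f has relatively compact range, finitely many phi suffice to find peak functions
   f_0 >= f_1 >= ... at x with J(norm(T (f_n - f_(n+1)))) >= A/2. But T (f_n - f_(n+1)) tends to 0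
   pointwise and J satisfies a bounded convergence theorem. *)
theory Submission
  imports Defs
begin

section \<open>The Mazur-Orlicz form of the Hahn-Banach theorem, by way of minimal sublinear
  functionals\<close>

subsection \<open>Sublinear functionals\<close>

text \<open>Two failures shape the argument. The first is of uniformity: that no y charges x gives
  each y its own neighbourhood of x, and x may have no countable neighbourhood base, so no sequence
  of bumps need exhaust these neighbourhoods. The functional J takes the place of "for all y": it
  keeps the lower bound A, yet obeys a bounded convergence theorem, which the supremum norm does
  not. The second is that norms do not add. For both signs r the norm of T g y + r T f y can be far
  below the sum of the two norms, whereas one of the signs gives phi (T g y) + |phi (T f y)|
  exactly. So maximality is argued for one functional at a time, and the passage to finitely many is
  made for the fixed function T f_n, before f_(n+1) is chosen. The two approximations cost A/4 each,
  and A/2 remains. In the counting, each y charges finitely many points at each level 1/(n+1),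
  whence |K| is at most |L| times aleph_0. For infinite L this is |L|; finite L needs a direct
  argument.\<close>

definition sublinear :: "('a::real_vector \<Rightarrow> real) \<Rightarrow> bool" where
  "sublinear p \<longleftrightarrow> (\<forall>u v. p (u + v) \<le> p u + p v) \<and> (\<forall>c u. 0 \<le> c \<longrightarrow> p (c *\<^sub>R u) = c * p u)"

lemma sublinear_add: "sublinear p \<Longrightarrow> p (u + v) \<le> p u + p v"
  and sublinear_scale: "sublinear p \<Longrightarrow> 0 \<le> c \<Longrightarrow> p (c *\<^sub>R u) = c * p u"
  by (auto simp: sublinear_def)

lemma sublinear_zero: "sublinear p \<Longrightarrow> p 0 = 0"
  using sublinear_scale[of p 0 0] by simp

lemma sublinear_uminus: "sublinear p \<Longrightarrow> - p (- u) \<le> p u"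
  using sublinear_add[of p u "- u"] sublinear_zero[of p] by simp

lemma sublinearI:
  assumes add: "\<And>u v. p (u + v) \<le> p u + p v"
    and scale: "\<And>c u. 0 < c \<Longrightarrow> p (c *\<^sub>R u) \<le> c * p u"
    and zero: "p 0 = 0"
  shows "sublinear p"
  unfolding sublinear_def
proof (intro conjI allI impI)
  fix c :: real and u assume c: "0 \<le> c"
  show "p (c *\<^sub>R u) = c * p u"
  proof (cases "c = 0")
    case False
    with c have c: "c > 0" by simp
    have "p ((1 / c) *\<^sub>R (c *\<^sub>R u)) \<le> (1 / c) * p (c *\<^sub>R u)"
      using c by (intro scale) simp
    then have "c * p u \<le> p (c *\<^sub>R u)" using c by (simp add: field_simps)
    with scale[OF c, of u] show ?thesis by simp
  qed (simp add: zero)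
qed (rule add)

text \<open>The infimum of \<open>p (u + t *\<^sub>R d) - t * a\<close> over
  \<open>t \<ge> 0\<close> and \<open>d \<in> D\<close> is the largest sublinear \<open>q\<close> of
  this kind. The bound at \<open>- d\<close> forces \<open>a \<le> f d\<close> for every linear
  \<open>f\<close> below \<open>q\<close>. A singleton \<open>D\<close> serves the Hahn-Banach
  theorem itself, a general one the Mazur-Orlicz form.\<close>

lemma sublinear_Inf_below:
  assumes p: "sublinear p" and D: "convex D" "D \<noteq> {}" and a: "\<And>d. d \<in> D \<Longrightarrow> a \<le> p d"
  shows "\<exists>q. sublinear q \<and> (\<forall>u. q u \<le> p u) \<and> (\<forall>d\<in>D. q (- d) \<le> - a)"
proof -
  define F where "F u = (\<lambda>(t, d). p (u + t *\<^sub>R d) - t * a)" for u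
  let ?I = "{0::real..} \<times> D"
  define q where "q u = (INF i\<in>?I. F u i)" for u
  obtain d0 where "d0 \<in> D" using D(2) by blast
  then have "(0, d0) \<in> ?I" by simp
  then have ne: "?I \<noteq> {}" by blast
  \<comment> \<open>The infimum is finite because \<open>a\<close> is a lower bound of
    \<open>p\<close> on \<open>D\<close>.\<close>
  have lower: "- p (- u) \<le> F u i" if i_in: "i \<in> ?I" for u i
  proof -
    obtain t d where i: "i = (t, d)" "t \<ge> 0" "d \<in> D" using i_in by (cases i) auto
    have "t * a \<le> p (t *\<^sub>R d)" using a[OF i(3)] i(2) p by (simp add: sublinear_scale mult_left_mono)
    also have "\<dots> \<le> p (u + t *\<^sub>R d) + p (- u)"
      using sublinear_add[OF p, of "u + t *\<^sub>R d" "- u"] by simp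
    finally show ?thesis by (simp add: i F_def)
  qed
  have bdd: "bdd_below (F u ` ?I)" for u using lower[of _ u] by (intro bdd_belowI2)
  have q_le: "q u \<le> p (u + t *\<^sub>R d) - t * a" if "t \<ge> 0" "d \<in> D" for u t d
    using cINF_lower[OF bdd, of "(t, d)" u] that by (auto simp: q_def F_def)
  have q_near: "\<exists>t d. t \<ge> 0 \<and> d \<in> D \<and> p (u + t *\<^sub>R d) - t * a < q u + e" if "e > 0" for u e
  proof -
    have "(INF i\<in>?I. F u i) < q u + e" using that by (simp add: q_def)
    then show ?thesis using cINF_less_iff[OF ne bdd] by (fastforce simp: F_def)
  qed
  have qp: "q u \<le> p u" for u
    using D q_le[of 0 _ u] by auto
  have "sublinear q"
  proof (rule sublinearI)
    fix u v show "q (u + v) \<le> q u + q v"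
    proof (rule field_le_epsilon)
      fix e :: real assume "e > 0"
      then have e: "e / 2 > 0" by simp
      obtain t d where td: "t \<ge> 0" "d \<in> D" "p (u + t *\<^sub>R d) - t * a < q u + e / 2" using q_near[OF e] by blast
      obtain s c where sc: "s \<ge> 0" "c \<in> D" "p (v + s *\<^sub>R c) - s * a < q v + e / 2" using q_near[OF e] by blast
      \<comment> \<open>Convexity enters here: the cone over \<open>D\<close> is closed under
        addition, with the weights adding up. Weight 0 has no normalisation and is treated
        apart.\<close>
      obtain b where b: "b \<in> D" "(t + s) *\<^sub>R b = t *\<^sub>R d + s *\<^sub>R c"
      proof (cases "t + s = 0")
        case True
        with td sc have "t = 0" "s = 0" by auto
        then show ?thesis using that[of d] td by simp
      next
        case False
        let ?b = "(t / (t + s)) *\<^sub>R d + (s / (t + s)) *\<^sub>R c"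
        have "?b \<in> D" using False td sc by (intro convexD[OF D(1)]) (auto simp: add_divide_distrib[symmetric])
        then show ?thesis using that[of ?b] False by (simp add: scaleR_add_right)
      qed
      have "q (u + v) \<le> p ((u + v) + (t + s) *\<^sub>R b) - (t + s) * a"
        using td sc b by (intro q_le) auto
      also have "(u + v) + (t + s) *\<^sub>R b = (u + t *\<^sub>R d) + (v + s *\<^sub>R c)" by (simp add: b)
      also have "p \<dots> \<le> p (u + t *\<^sub>R d) + p (v + s *\<^sub>R c)" by (rule sublinear_add[OF p])
      finally show "q (u + v) \<le> q u + q v + e" using td sc by (simp add: algebra_simps)
    qed
  next
    fix c :: real and u assume c: "c > 0"
    show "q (c *\<^sub>R u) \<le> c * q u"
    proof (rule field_le_epsilon)
      fix e :: real assume "e > 0"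
      then have e: "e / c > 0" using c by simp
      obtain t d where td: "t \<ge> 0" "d \<in> D" "p (u + t *\<^sub>R d) - t * a < q u + e / c" using q_near[OF e] by blast
      have "q (c *\<^sub>R u) \<le> p (c *\<^sub>R u + (c * t) *\<^sub>R d) - (c * t) * a" using td c by (intro q_le) auto
      also have "c *\<^sub>R u + (c * t) *\<^sub>R d = c *\<^sub>R (u + t *\<^sub>R d)" by (simp add: scaleR_add_right)
      also have "p \<dots> - (c * t) * a = c * (p (u + t *\<^sub>R d) - t * a)" 
        using c by (subst sublinear_scale[OF p]) (simp_all add: algebra_simps)
      also have "\<dots> \<le> c * (q u + e / c)" using td c by (intro mult_left_mono) auto
      finally show "q (c *\<^sub>R u) \<le> c * q u + e" using c by (simp add: algebra_simps)
    qed
  next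
    show "q 0 = 0"
    proof (rule antisym)
      show "q 0 \<le> 0" using qp[of 0] sublinear_zero[OF p] by simp
      show "0 \<le> q 0" unfolding q_def using lower[of _ 0] sublinear_zero[OF p] by (intro cINF_greatest[OF ne]) auto
    qed
  qed
  moreover have "q (- d) \<le> - a" if "d \<in> D" for d
    using q_le[of 1 d "- d"] that sublinear_zero[OF p] by simp
  ultimately show ?thesis using qp by blast
qed

text \<open>A minimal sublinear \<open>m\<close> below \<open>p\<close> is linear. Lowering it with
  \<open>D = {v}\<close> and \<open>a = m v\<close> gives \<open>q (- v) \<le> - m v\<close>, and
  minimality says \<open>q = m\<close>; so \<open>m\<close> is odd, and an odd sublinear functional
  is linear.\<close>

lemma hahn_banach_sublinear:
  assumes p: "sublinear p"
  shows "\<exists>f. linear f \<and> (\<forall>u. f u \<le> p u)"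
proof -
  define S where "S = {q. sublinear q \<and> (\<forall>u. q u \<le> p u)}"
  \<comment> \<open>The order given to Zorn's lemma is reversed, so its maximal element is a minimal
    functional.\<close>
  have "\<exists>m\<in>S. \<forall>q\<in>S. (\<forall>u. q u \<le> m u) \<longrightarrow> q = m"
  proof (rule predicate_Zorn)
    show "partial_order_on S (relation_of (\<lambda>m q. \<forall>u. q u \<le> m u) S)"
      by (rule partial_order_on_relation_ofI) (auto intro: order_trans antisym simp: fun_eq_iff)
  next
    fix C assume C: "C \<in> Chains (relation_of (\<lambda>m q. \<forall>u. q u \<le> m u) S)"
    then have CS: "C \<subseteq> S" by (auto simp: Chains_def relation_of_def)
    have chain: "(\<forall>u. q u \<le> r u) \<or> (\<forall>u. r u \<le> q u)" if "q \<in> C" "r \<in> C" for q r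
      using C that by (auto simp: Chains_def relation_of_def)
    show "\<exists>m\<in>S. \<forall>q\<in>C. \<forall>u. m u \<le> q u"
    proof (cases "C = {}")
      case True
      then show ?thesis using p by (auto simp: S_def)
    next
      case ne: False
      define m where "m u = (INF q\<in>C. q u)" for u
      \<comment> \<open>This bound is the same for all members of the chain, so their infimum is
        finite.\<close>
      have lower: "- p (- u) \<le> q u" if "q \<in> C" for q u
        using that CS sublinear_uminus[of q u] unfolding S_def
        by (smt (verit, best) mem_Collect_eq subsetD)
      have bdd: "bdd_below ((\<lambda>q. q u) ` C)" for u using lower[of _ u] by (intro bdd_belowI2)
      have m_le: "m u \<le> q u" if "q \<in> C" for q u unfolding m_def by (rule cINF_lower[OF bdd that])
      have near: "\<exists>q\<in>C. q u < m u + e" if "e > 0" for u e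
        using cINF_less_iff[OF ne bdd, of u "m u + e"] that by (simp add: m_def)
      have "sublinear m"
      proof (rule sublinearI)
        fix u v show "m (u + v) \<le> m u + m v"
        proof (rule field_le_epsilon)
          fix e :: real assume "e > 0"
          then have e: "e / 2 > 0" by simp
          obtain q r where q: "q \<in> C" "q u < m u + e / 2" and r: "r \<in> C" "r v < m v + e / 2"
            using near[OF e] by metis
          obtain s where s: "s \<in> C" "s u \<le> q u" "s v \<le> r v" using chain[OF q(1) r(1)] q r by blast
          have "m (u + v) \<le> s (u + v)" using s by (intro m_le)
          also have "\<dots> \<le> s u + s v" using s CS by (intro sublinear_add) (auto simp: S_def)
          finally show "m (u + v) \<le> m u + m v + e" using q r s by simp
        qed
      next
        fix c :: real and u assume c: "c > 0"
        show "m (c *\<^sub>R u) \<le> c * m u"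
        proof (rule field_le_epsilon)
          fix e :: real assume "e > 0"
          then have e: "e / c > 0" using c by simp
          obtain q where q: "q \<in> C" "q u < m u + e / c" using near[OF e] by metis
          have "m (c *\<^sub>R u) \<le> q (c *\<^sub>R u)" using q by (intro m_le)
          also have "\<dots> = c * q u" using q CS c by (intro sublinear_scale) (auto simp: S_def)
          also have "\<dots> \<le> c * (m u + e / c)" using q c by (intro mult_left_mono) auto
          finally show "m (c *\<^sub>R u) \<le> c * m u + e" using c by (simp add: algebra_simps)
        qed
      next
        have "q 0 = 0" if "q \<in> C" for q using that CS by (auto simp: S_def sublinear_zero)
        then have "(\<lambda>q. q 0) ` C = {0}" using ne by (auto simp: image_def)
        then show "m 0 = 0" by (simp add: m_def)
      qed
      moreover have "m u \<le> p u" for u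
      proof -
        obtain q where "q \<in> C" using ne by blast
        then show ?thesis using m_le[of q u] CS by (force simp: S_def intro: order_trans)
      qed
      ultimately show ?thesis using m_le by (auto simp: S_def)
    qed
  qed
  then obtain m where m: "m \<in> S" and min: "\<And>q. q \<in> S \<Longrightarrow> (\<And>u. q u \<le> m u) \<Longrightarrow> q = m" by blast
  have sub: "sublinear m" using m by (simp add: S_def)
  have neg: "m (- v) = - m v" for v
  proof -
    obtain q where q: "sublinear q" "\<And>u. q u \<le> m u" "q (- v) \<le> - m v"
      using sublinear_Inf_below[OF sub, of "{v}" "m v"] by auto
    have "q \<in> S" using q m by (auto simp: S_def intro: order_trans)
    with min q have "q = m" by blast
    then show ?thesis using q(3) sublinear_uminus[OF sub, of v] by simp
  qed
  have "m (u + v) = m u + m v" for u v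
    using sublinear_add[OF sub, of u v] sublinear_add[OF sub, of "- u" "- v"]
      neg[of u] neg[of v] neg[of "u + v"] by simp
  moreover have "m (c *\<^sub>R u) = c * m u" for c u
  proof (cases "c \<ge> 0")
    case False
    then have "m ((- c) *\<^sub>R u) = (- c) * m u" by (intro sublinear_scale[OF sub]) auto
    then show ?thesis using neg[of "c *\<^sub>R u"] by simp
  qed (simp add: sublinear_scale[OF sub])
  ultimately have "linear m" by (intro linearI) auto
  then show ?thesis using m by (auto simp: S_def)
qed

text \<open>One \<open>f\<close> serves all of \<open>D\<close>. This uniformity later yields a
  single positive functional for all functions with value 1 at a point.\<close>

lemma mazur_orlicz:
  assumes "sublinear p" "convex D" "D \<noteq> {}" "\<And>d. d \<in> D \<Longrightarrow> a \<le> p d"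
  shows "\<exists>f. linear f \<and> (\<forall>u. f u \<le> p u) \<and> (\<forall>d\<in>D. a \<le> f d)"
proof -
  obtain q where q: "sublinear q" "\<And>u. q u \<le> p u" "\<And>d. d \<in> D \<Longrightarrow> q (- d) \<le> - a"
    using sublinear_Inf_below[OF assms] by blast
  obtain f where f: "linear f" "\<And>u. f u \<le> q u" using hahn_banach_sublinear[OF q(1)] by blast
  have "a \<le> f d" if "d \<in> D" for d
    using f(2)[of "- d"] q(3)[OF that] linear_neg[OF f(1), of d] by simp
  then show ?thesis using f q(2) by (meson order_trans)
qed

text \<open>The closed unit ball of the dual, as plain functions, since \<open>mazur_orlicz\<close>
  supplies functionals in this form.\<close>

definition contraction_functional :: "('a::real_normed_vector \<Rightarrow> real) \<Rightarrow> bool" where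
  "contraction_functional \<phi> \<longleftrightarrow> linear \<phi> \<and> (\<forall>v. \<bar>\<phi> v\<bar> \<le> norm v)"

lemma contraction_functionalD:
  assumes "contraction_functional \<phi>"
  shows "bounded_linear \<phi>" "linear \<phi>" "\<bar>\<phi> v\<bar> \<le> norm v"
  using assms by (auto simp: contraction_functional_def bounded_linear_axioms_def bounded_linear_def
      intro!: exI[of _ 1])

lemma norming_functional:
  fixes v :: "'a::real_normed_vector"
  shows "\<exists>\<phi>. contraction_functional \<phi> \<and> \<phi> v = norm v"
proof -
  have "sublinear (norm :: 'a \<Rightarrow> real)" by (auto simp: sublinear_def norm_triangle_ineq)
  from mazur_orlicz[OF this, of "{v}" "norm v"]
  obtain f where f: "linear f" "\<And>u. f u \<le> norm u" "norm v \<le> f v" by auto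
  have "\<bar>f u\<bar> \<le> norm u" for u using f(2)[of u] f(2)[of "- u"] linear_neg[OF f(1), of u] by auto
  then show ?thesis using f by (auto simp: contraction_functional_def intro: antisym)
qed

section \<open>Rosenthal's lemma on matrices and the Bessaga-Pelczynski theorem\<close>

subsection \<open>Copies of c0\<close>

(* Split N into infinitely many infinite blocks. If no block works, choose a bad row from each: on the
   set of these rows the row sums have dropped by e. *)
lemma rosenthal_matrix:
  fixes x :: "nat \<Rightarrow> nat \<Rightarrow> real"
  assumes nn: "\<And>n k. 0 \<le> x n k" and e: "e > 0"
    and N: "infinite N" and bnd: "\<And>n S. n \<in> N \<Longrightarrow> finite S \<Longrightarrow> S \<subseteq> N \<Longrightarrow> (\<Sum>k\<in>S. x n k) \<le> real r * e"
  shows "\<exists>N'\<subseteq>N. infinite N' \<and> (\<forall>n\<in>N'. \<forall>S. finite S \<longrightarrow> S \<subseteq> N' - {n} \<longrightarrow> (\<Sum>k\<in>S. x n k) \<le> e)"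
  using N bnd
proof (induction r arbitrary: N)
  case 0
  show ?case
  proof (intro exI[of _ N] conjI ballI allI impI)
    fix n S assume "n \<in> N" "finite S" "S \<subseteq> N - {n}"
    then have "(\<Sum>k\<in>S. x n k) \<le> real 0 * e" by (intro 0) auto
    with e show "(\<Sum>k\<in>S. x n k) \<le> e" by simp
  qed (use 0 in auto)
next
  case (Suc r)
  obtain b :: "nat \<Rightarrow> nat" where b: "bij_betw b UNIV N"
    using Suc.prems(1) by (meson countableI_type countableE_infinite bij_betw_inv_into)
  define P where "P p = b ` range (\<lambda>i. prod_encode (p, i))" for p
  have PN: "P p \<subseteq> N" for p using b by (auto simp: P_def bij_betw_def)
  have inj_b: "inj b" using b by (simp add: bij_betw_def)
  have Pinf: "infinite (P p)" for p
  proof -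
    have "inj (\<lambda>i. b (prod_encode (p, i)))"
      by (intro injI) (auto dest!: injD[OF inj_b])
    then show ?thesis unfolding P_def image_image by (metis finite_imageD infinite_UNIV_nat)
  qed
  have Pdisj: "P p \<inter> P q = {}" if "p \<noteq> q" for p q
    using that by (auto simp: P_def dest!: injD[OF inj_b])
  show ?case
  proof (cases "\<exists>p. \<forall>n\<in>P p. \<forall>S. finite S \<longrightarrow> S \<subseteq> P p - {n} \<longrightarrow> (\<Sum>k\<in>S. x n k) \<le> e")
    case True
    then show ?thesis using PN Pinf by metis
  next
    case False
    then have "\<forall>p. \<exists>n S. n \<in> P p \<and> finite S \<and> S \<subseteq> P p - {n} \<and> (\<Sum>k\<in>S. x n k) > e"
      by (meson not_le)
    then obtain n S where nS: "\<And>p. n p \<in> P p" "\<And>p. finite (S p)" "\<And>p. S p \<subseteq> P p - {n p}"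
      "\<And>p. (\<Sum>k\<in>S p. x (n p) k) > e" by metis
    have inj_n: "inj n" using nS(1) Pdisj by (metis disjoint_iff injI)
    have nN: "range n \<subseteq> N" using nS(1) PN by blast
    \<comment> \<open>\<open>S p\<close> lies in block \<open>p\<close> and omits
      \<open>n p\<close>, the only chosen row of that block. Its columns therefore come in addition
      to those of any set of chosen rows.\<close>
    have disj: "S p \<inter> range n = {}" for p
    proof -
      have "n q \<notin> S p" for q
        using nS(1)[of q] nS(3)[of p] Pdisj[of p q] by (cases "p = q") blast+
      then show ?thesis by blast
    qed
    have "\<exists>N'\<subseteq>range n. infinite N' \<and> (\<forall>m\<in>N'. \<forall>S. finite S \<longrightarrow> S \<subseteq> N' - {m} \<longrightarrow> (\<Sum>k\<in>S. x m k) \<le> e)"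
    proof (rule Suc.IH)
      show "infinite (range n)" using inj_n by (simp add: finite_image_iff)
      fix m F assume m: "m \<in> range n" and F: "finite F" "F \<subseteq> range n"
      then obtain p where p: "m = n p" by blast
      have "(\<Sum>k\<in>F. x m k) + (\<Sum>k\<in>S p. x m k) = (\<Sum>k\<in>F \<union> S p. x m k)"
        using F nS(2) disj[of p] by (subst sum.union_disjoint) auto
      also have "\<dots> \<le> real (Suc r) * e"
        using p F nS(2,3) nN PN by (intro Suc.prems(2)) blast+
      finally show "(\<Sum>k\<in>F. x m k) \<le> real r * e" using nS(4)[of p] p by (simp add: algebra_simps)
    qed
    then show ?thesis using nN by (meson order_trans)
  qed
qed

lemma compact_nat_finite: "compact (C :: nat set) \<Longrightarrow> finite C"
  using compactE_image[of C C "\<lambda>n. {n}"] by (auto simp: open_discrete intro: finite_subset)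

lemma C0_bounded:
  assumes "f \<in> C0" shows "bounded (range f)"
proof -
  have c: "continuous_on UNIV f" and "vanishes_at_infinity f" using assms by (simp_all add: C0_def)
  then obtain C where C: "compact C" "\<And>x. x \<notin> C \<Longrightarrow> norm (f x) < 1"
    unfolding vanishes_at_infinity_def using zero_less_one by blast
  have "bounded (f ` C)"
    by (rule compact_imp_bounded[OF compact_continuous_image[OF continuous_on_subset[OF c subset_UNIV] C(1)]])
  moreover have "bounded (f ` (- C))"
    unfolding bounded_iff using C(2) by (intro exI[of _ 1]) (auto intro: less_imp_le)
  moreover have "range f = f ` C \<union> f ` (- C)" by auto
  ultimately show ?thesis by simp
qed

lemma norm_le_supnorm: "f \<in> C0 \<Longrightarrow> norm (f x) \<le> supnorm f"
  unfolding supnorm_def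
  using C0_bounded[of f] by (intro cSUP_upper bounded_imp_bdd_above) (auto simp: bounded_iff)

lemma supnorm_le: "(\<And>x. norm (f x) \<le> b) \<Longrightarrow> supnorm f \<le> b"
  unfolding supnorm_def by (rule cSUP_least) auto

lemma vanishes_at_infinity_nat_iff:
  fixes a :: "nat \<Rightarrow> 'b::real_normed_vector"
  shows "vanishes_at_infinity a \<longleftrightarrow> a \<longlonglongrightarrow> 0"
proof
  assume "vanishes_at_infinity a"
  then show "a \<longlonglongrightarrow> 0"
    unfolding LIMSEQ_iff
  proof (intro allI impI)
    fix e :: real assume "e > 0"
    then obtain C where C: "compact C" "\<And>n. n \<notin> C \<Longrightarrow> norm (a n) < e"
      using \<open>vanishes_at_infinity a\<close> unfolding vanishes_at_infinity_def by blast
    obtain m where "\<And>n. n \<in> C \<Longrightarrow> n < m"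
      using compact_nat_finite[OF C(1)] by (auto simp: finite_nat_set_iff_bounded)
    then show "\<exists>m. \<forall>n\<ge>m. norm (a n - 0) < e" using C(2) by (metis diff_zero not_less)
  qed
next
  assume "a \<longlonglongrightarrow> 0"
  show "vanishes_at_infinity a" unfolding vanishes_at_infinity_def
  proof (intro allI impI)
    fix e :: real assume "e > 0"
    then obtain n where "\<And>m. m \<ge> n \<Longrightarrow> norm (a m) < e" using \<open>a \<longlonglongrightarrow> 0\<close> by (auto simp: LIMSEQ_iff)
    then show "\<exists>C. compact C \<and> (\<forall>x. x \<notin> C \<longrightarrow> norm (a x) < e)"
      by (intro exI[of _ "{..<n}"]) (auto intro: finite_imp_compact)
  qed
qed

text \<open>This is the Bessaga-Pelczynski theorem. Let \<open>\<phi> n\<close> norm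
  \<open>v n\<close>. Rosenthal's lemma for the matrix \<open>\<bar>\<phi> n (v k)\<bar>\<close>
  gives a subsequence on which each functional nearly ignores all vectors but its own. It then
  detects its own coefficient, which bounds the sums from below.\<close>

lemma contains_copy_of_c0I:
  fixes v :: "nat \<Rightarrow> 'x::banach"
  assumes bnd: "\<And>S a. finite S \<Longrightarrow> (\<And>n. \<bar>a n\<bar> \<le> 1) \<Longrightarrow> norm (\<Sum>n\<in>S. a n *\<^sub>R v n) \<le> B"
    and d: "d > 0" and big: "\<And>n. d \<le> norm (v n)"
  shows "contains_copy_of_c0 TYPE('x)"
proof -
  have bnd': "norm (\<Sum>n\<in>S. a n *\<^sub>R v n) \<le> B * c" if "finite S" "\<And>n. n \<in> S \<Longrightarrow> \<bar>a n\<bar> \<le> c" "c > 0" for S a c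
  proof -
    have "norm (\<Sum>n\<in>S. (if n \<in> S then a n / c else 0) *\<^sub>R v n) \<le> B"
      by (rule bnd) (use that in \<open>auto simp: abs_divide\<close>)
    also have "(\<Sum>n\<in>S. (if n \<in> S then a n / c else 0) *\<^sub>R v n) = (1 / c) *\<^sub>R (\<Sum>n\<in>S. a n *\<^sub>R v n)"
      unfolding scaleR_sum_right by (rule sum.cong) auto
    finally show ?thesis using that(3) by (simp add: field_simps)
  qed
  have B0: "B \<ge> 0" using bnd[of "{}" "\<lambda>_. 0"] by simp
  have "\<forall>n. \<exists>\<phi>. contraction_functional \<phi> \<and> \<phi> (v n) = norm (v n)" using norming_functional by blast
  then obtain \<phi> where phi: "\<And>n. contraction_functional (\<phi> n)" "\<And>n. \<phi> n (v n) = norm (v n)" by metis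
  note phi_lin = contraction_functionalD(2)[OF phi(1)] and phi_le = contraction_functionalD(3)[OF phi(1)]
  \<comment> \<open>The functional of index \<open>j\<close> keeps
    \<open>d * \<bar>a j\<bar>\<close> up to \<open>e\<close> times the norm of \<open>a\<close>.
    With half of \<open>d\<close> the lower constant is \<open>d - e = e\<close>.\<close>
  define e where "e = d / 2"
  have e: "e > 0" using d by (simp add: e_def)
  obtain r :: nat where r: "B \<le> real r * e" 
    using real_arch_simple[of "B / e"] e by (auto simp: field_simps)
  have rows: "(\<Sum>k\<in>S. \<bar>\<phi> n (v k)\<bar>) \<le> real r * e" if "finite S" for n S
  proof -
    \<comment> \<open>With the signs as coefficients, the row sum is a single value of
      \<open>\<phi> n\<close> at an admissible sum.\<close>
    have "(\<Sum>k\<in>S. \<bar>\<phi> n (v k)\<bar>) = \<phi> n (\<Sum>k\<in>S. sgn (\<phi> n (v k)) *\<^sub>R v k)"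
      unfolding linear_sum[OF phi_lin] linear_cmul[OF phi_lin] by (intro sum.cong refl) (simp add: abs_sgn mult.commute)
    also have "\<dots> \<le> norm (\<Sum>k\<in>S. sgn (\<phi> n (v k)) *\<^sub>R v k)" using phi_le abs_le_D1 by blast
    also have "\<dots> \<le> B" using that by (intro bnd) (auto simp: sgn_real_def)
    finally show ?thesis using r by simp
  qed
  have "\<exists>N\<subseteq>UNIV. infinite N \<and> (\<forall>n\<in>N. \<forall>S. finite S \<longrightarrow> S \<subseteq> N - {n} \<longrightarrow> (\<Sum>k\<in>S. \<bar>\<phi> n (v k)\<bar>) \<le> e)"
  proof (rule rosenthal_matrix[where r = r])
    show "(\<Sum>k\<in>S. \<bar>\<phi> n (v k)\<bar>) \<le> real r * e" if "finite S" for n S by (rule rows[OF that])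
  qed (use e in simp_all)
  then obtain N where N: "infinite N"
    "\<And>n S. n \<in> N \<Longrightarrow> finite S \<Longrightarrow> S \<subseteq> N - {n} \<Longrightarrow> (\<Sum>k\<in>S. \<bar>\<phi> n (v k)\<bar>) \<le> e"
    by (elim exE conjE) (rule that, assumption, elim ballE allE impE, assumption+, simp)
  define s where "s = enumerate N"
  have s: "strict_mono s" "\<And>i. s i \<in> N" using N(1) by (auto simp: s_def strict_mono_enumerate enumerate_in_set)
  have inj_s: "inj s" using s(1) strict_mono_imp_inj_on by blast
  have upper: "norm (\<Sum>i\<in>S. a i *\<^sub>R v (s i)) \<le> B * c" if "finite S" "\<And>i. i \<in> S \<Longrightarrow> \<bar>a i\<bar> \<le> c" "c > 0" for S a c
  proof -
    have "(\<Sum>i\<in>S. a i *\<^sub>R v (s i)) = (\<Sum>n\<in>s ` S. a (inv s n) *\<^sub>R v n)"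
      using inj_s by (simp add: sum.reindex inj_on_subset[OF inj_s] inv_f_f)
    moreover have "norm (\<Sum>n\<in>s ` S. a (inv s n) *\<^sub>R v n) \<le> B * c"
      using that inj_s by (intro bnd') (auto simp: inv_f_f)
    ultimately show ?thesis by simp
  qed
  have lower: "d * \<bar>a j\<bar> - e * c \<le> norm (\<Sum>i<n. a i *\<^sub>R v (s i))"
    if a: "\<And>i. \<bar>a i\<bar> \<le> c" and j: "j < n" for a c j n
  proof -
    let ?f = "\<phi> (s j)" and ?T = "\<Sum>i\<in>{..<n} - {j}. a i *\<^sub>R v (s i)"
    have c: "c \<ge> 0" using a[of 0] by simp
    have "(\<Sum>i<n. a i *\<^sub>R v (s i)) = a j *\<^sub>R v (s j) + ?T" using j by (simp add: sum.remove)
    then have 1: "?f (\<Sum>i<n. a i *\<^sub>R v (s i)) = a j * norm (v (s j)) + ?f ?T"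
      by (simp add: linear_add[OF phi_lin] linear_cmul[OF phi_lin] phi)
    have "?f ?T = (\<Sum>i\<in>{..<n} - {j}. a i * ?f (v (s i)))"
      by (simp add: linear_sum[OF phi_lin] linear_cmul[OF phi_lin])
    also have "\<bar>\<dots>\<bar> \<le> (\<Sum>i\<in>{..<n} - {j}. \<bar>a i * ?f (v (s i))\<bar>)" by (rule sum_abs)
    also have "\<dots> = (\<Sum>i\<in>{..<n} - {j}. \<bar>a i\<bar> * \<bar>?f (v (s i))\<bar>)" by (simp only: abs_mult)
    also have "\<dots> \<le> (\<Sum>i\<in>{..<n} - {j}. c * \<bar>?f (v (s i))\<bar>)" using a by (intro sum_mono mult_right_mono) auto
    also have "\<dots> = c * (\<Sum>k\<in>s ` ({..<n} - {j}). \<bar>?f (v k)\<bar>)"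
      by (simp add: sum.reindex inj_on_subset[OF inj_s] sum_distrib_left)
    also have "\<dots> \<le> c * e" using c s(2) inj_s by (intro mult_left_mono N(2)) (auto simp: inj_eq)
    finally have 2: "\<bar>?f ?T\<bar> \<le> c * e" .
    have 3: "d * \<bar>a j\<bar> \<le> \<bar>a j * norm (v (s j))\<bar>" using big[of "s j"] by (simp add: abs_mult mult.commute[of d] mult_left_mono)
    have "\<bar>?f (\<Sum>i<n. a i *\<^sub>R v (s i))\<bar> \<le> norm (\<Sum>i<n. a i *\<^sub>R v (s i))" by (rule phi_le)
    with 1 2 3 show ?thesis by (simp add: mult.commute)
  qed
  define R where "R a = (\<Sum>i. a i *\<^sub>R v (s i))" for a
  have summ: "summable (\<lambda>i. a i *\<^sub>R v (s i))" if "a \<in> c0" for a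
  proof -
    have a0: "a \<longlonglongrightarrow> 0" using that by (simp add: C0_def vanishes_at_infinity_nat_iff)
    show ?thesis unfolding summable_Cauchy
    proof (intro allI impI)
      fix \<epsilon> :: real assume eps: "\<epsilon> > 0"
      define c where "c = \<epsilon> / (2 * (B + 1))"
      have c: "c > 0" "B * c < \<epsilon>" using eps B0 by (auto simp: c_def field_simps add_nonneg_pos)
      obtain m where m: "\<And>i. i \<ge> m \<Longrightarrow> \<bar>a i\<bar> < c" using a0 c(1) by (auto simp: LIMSEQ_iff)
      show "\<exists>N. \<forall>m\<ge>N. \<forall>n. norm (\<Sum>i = m..<n. a i *\<^sub>R v (s i)) < \<epsilon>"
      proof (intro exI[of _ m] allI impI)
        fix l n assume "l \<ge> m"
        then have "norm (\<Sum>i = l..<n. a i *\<^sub>R v (s i)) \<le> B * c"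
          using m c(1) by (intro upper) (auto intro: less_imp_le)
        then show "norm (\<Sum>i = l..<n. a i *\<^sub>R v (s i)) < \<epsilon>" using c(2) by simp
      qed
    qed
  qed
  have R_lim: "(\<lambda>n. norm (\<Sum>i<n. a i *\<^sub>R v (s i))) \<longlonglongrightarrow> norm (R a)" if "a \<in> c0" for a
    using summable_LIMSEQ[OF summ[OF that]] by (simp add: R_def tendsto_norm)
  \<comment> \<open>An embedding needs a positive upper constant, and of \<open>B\<close> only
    nonnegativity has been recorded; hence \<open>B + 1\<close>.\<close>
  have R_upper: "norm (R a) \<le> (B + 1) * supnorm a" if a: "a \<in> c0" for a
  proof (cases "supnorm a > 0")
    case True
    have "norm (\<Sum>i<n. a i *\<^sub>R v (s i)) \<le> B * supnorm a" for n
      using norm_le_supnorm[OF a] True by (intro upper) auto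
    then have "norm (R a) \<le> B * supnorm a" by (intro LIMSEQ_le_const2[OF R_lim[OF a]]) auto
    then show ?thesis using True by (simp add: algebra_simps)
  next
    case False
    then have "\<And>i. a i = 0" using norm_le_supnorm[OF a] by (metis norm_le_zero_iff not_less order_trans)
    then show ?thesis using False norm_le_supnorm[OF a, of 0] by (simp add: R_def)
  qed
  have R_lower: "e * supnorm a \<le> norm (R a)" if a: "a \<in> c0" for a
  proof -
    have "d * \<bar>a j\<bar> - e * supnorm a \<le> norm (R a)" for j
      using lower[of a "supnorm a" j] norm_le_supnorm[OF a]
      by (intro LIMSEQ_le_const[OF R_lim[OF a]] exI[of _ "Suc j"]) auto
    then have "norm (a j) \<le> (norm (R a) + e * supnorm a) / d" for j
      using d by (simp add: field_simps)
    then have "supnorm a \<le> (norm (R a) + e * supnorm a) / d" by (rule supnorm_le)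
    then show ?thesis using d by (simp add: e_def field_simps)
  qed
  have "\<exists>A B. A > 0 \<and> B > 0 \<and> (\<forall>f\<in>c0. A * supnorm f \<le> norm (R f) \<and> norm (R f) \<le> B * supnorm f)"
    by (rule exI[of _ e], rule exI[of _ "B + 1"]) (use e B0 R_upper R_lower in auto)
  then have "iso_embedding_into_space c0 R"
    unfolding iso_embedding_into_space_def
  proof (intro conjI ballI allI)
    fix f g :: "nat \<Rightarrow> real" assume fg: "f \<in> c0" "g \<in> c0"
    show "R (\<lambda>x. f x + g x) = R f + R g"
      unfolding R_def scaleR_add_left by (rule suminf_add[symmetric]) (use fg summ in auto)
  next
    fix c and f :: "nat \<Rightarrow> real" assume f: "f \<in> c0"
    show "R (\<lambda>x. c *\<^sub>R f x) = c *\<^sub>R R f"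
      using suminf_scaleR_right[OF summ[OF f], of c] by (simp add: R_def)
  qed
  then show ?thesis unfolding contains_copy_of_c0_def by (rule exI[of _ R])
qed

text \<open>Otherwise some subsequence stays at norm at least \<open>d\<close>. It inherits the
  bound on signed sums and so yields a copy of \<open>c0\<close>.\<close>

lemma weakly_summable_imp_null:
  fixes v :: "nat \<Rightarrow> 'x::banach"
  assumes no: "\<not> contains_copy_of_c0 TYPE('x)"
    and bnd: "\<And>S a. finite S \<Longrightarrow> (\<And>n. \<bar>a n\<bar> \<le> 1) \<Longrightarrow> norm (\<Sum>n\<in>S. a n *\<^sub>R v n) \<le> B"
  shows "v \<longlonglongrightarrow> 0"
proof (rule ccontr)
  assume "\<not> v \<longlonglongrightarrow> 0"
  then obtain d where d: "d > 0" "\<And>m. \<exists>n\<ge>m. d \<le> norm (v n)" by (auto simp: LIMSEQ_iff not_less)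
  then have inf: "infinite {n. d \<le> norm (v n)}" (is "infinite ?N")
    unfolding infinite_nat_iff_unbounded_le by auto
  define s where "s = enumerate ?N"
  have s: "inj s" "\<And>i. d \<le> norm (v (s i))"
    using strict_mono_imp_inj_on[OF strict_mono_enumerate[OF inf]] enumerate_in_set[OF inf] by (auto simp: s_def)
  have sub: "norm (\<Sum>n\<in>S. a n *\<^sub>R v (s n)) \<le> B" if "finite S" "\<And>n. \<bar>a n\<bar> \<le> 1" for S a
  proof -
    have "(\<Sum>i\<in>S. a i *\<^sub>R v (s i)) = (\<Sum>n\<in>s ` S. a (inv s n) *\<^sub>R v n)"
      using s(1) by (simp add: sum.reindex inj_on_subset[OF s(1)] inv_f_f)
    also have "norm \<dots> \<le> B" using that by (intro bnd) auto
    finally show ?thesis .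
  qed
  have "contains_copy_of_c0 TYPE('x)"
    by (rule contains_copy_of_c0I[of "\<lambda>n. v (s n)", OF sub d(1) s(2)])
  with no show False by contradiction
qed

subsection \<open>Continuous functions vanishing at infinity\<close>

lemma C0_continuous: "f \<in> C0 \<Longrightarrow> continuous_on UNIV f"
  by (simp add: C0_def)

lemma C0_small_off_compact:
  assumes "f \<in> C0" "e > 0"
  obtains C where "compact C" "\<And>x. x \<notin> C \<Longrightarrow> norm (f x) < e"
  using assms unfolding C0_def vanishes_at_infinity_def by blast

lemma C0_dominated:
  assumes g: "g \<in> C0" and f: "continuous_on UNIV f" and le: "\<And>x. norm (f x) \<le> norm (g x)"
  shows "f \<in> C0"
proof -
  have "\<exists>C. compact C \<and> (\<forall>x. x \<notin> C \<longrightarrow> norm (f x) < e)" if e: "e > 0" for e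
  proof -
    obtain C where "compact C" "\<And>x. x \<notin> C \<Longrightarrow> norm (g x) < e" using C0_small_off_compact[OF g e] by blast
    then show ?thesis using le by (meson le_less_trans)
  qed
  then show ?thesis using f by (simp add: C0_def vanishes_at_infinity_def)
qed

lemma C0_add:
  assumes f: "f \<in> C0" and g: "g \<in> C0" shows "(\<lambda>x. f x + g x) \<in> C0"
proof -
  have "\<exists>C. compact C \<and> (\<forall>x. x \<notin> C \<longrightarrow> norm (f x + g x) < e)" if "e > 0" for e
  proof -
    have e: "e / 2 > 0" using that by simp
    obtain C where C: "compact C" "\<And>x. x \<notin> C \<Longrightarrow> norm (f x) < e / 2" using C0_small_off_compact[OF f e] by blast
    obtain D where D: "compact D" "\<And>x. x \<notin> D \<Longrightarrow> norm (g x) < e / 2" using C0_small_off_compact[OF g e] by blast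
    have "norm (f x + g x) < e" if "x \<notin> C \<union> D" for x
      using that C(2)[of x] D(2)[of x] norm_triangle_ineq[of "f x" "g x"] by auto
    then show ?thesis using compact_Un[OF C(1) D(1)] by blast
  qed
  then show ?thesis using f g by (simp add: C0_def vanishes_at_infinity_def continuous_on_add)
qed

lemma C0_zero: "(\<lambda>x. 0) \<in> C0"
  by (auto simp: C0_def vanishes_at_infinity_def intro: exI[of _ "{}"])

lemma C0_scale:
  assumes f: "f \<in> C0" shows "(\<lambda>x. c *\<^sub>R f x) \<in> C0"
proof -
  have "\<exists>C. compact C \<and> (\<forall>x. x \<notin> C \<longrightarrow> norm (c *\<^sub>R f x) < e)" if "e > 0" for e
  proof -
    have e: "e / (\<bar>c\<bar> + 1) > 0" using that by simp
    obtain C where C: "compact C" "\<And>x. x \<notin> C \<Longrightarrow> norm (f x) < e / (\<bar>c\<bar> + 1)" using C0_small_off_compact[OF f e] by blast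
    have "norm (c *\<^sub>R f x) < e" if "x \<notin> C" for x
    proof -
      have "norm (c *\<^sub>R f x) \<le> (\<bar>c\<bar> + 1) * norm (f x)" by (simp add: mult_right_mono)
      also have "\<dots> < e" using C(2)[OF that] by (simp add: field_simps)
      finally show ?thesis .
    qed
    then show ?thesis using C(1) by blast
  qed
  then show ?thesis using f by (simp add: C0_def vanishes_at_infinity_def continuous_on_scaleR)
qed

lemma C0_diff: "f \<in> C0 \<Longrightarrow> g \<in> C0 \<Longrightarrow> (\<lambda>x. f x - g x) \<in> C0"
  using C0_add[of f "\<lambda>x. (-1) *\<^sub>R g x"] C0_scale[of g "-1"] by simp

lemma C0_sum: "(\<And>i. i \<in> S \<Longrightarrow> f i \<in> C0) \<Longrightarrow> (\<lambda>x. \<Sum>i\<in>S. f i x) \<in> C0"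
  by (induction S rule: infinite_finite_induct) (auto simp: C0_zero C0_add)

lemma C0_norm: "f \<in> C0 \<Longrightarrow> (\<lambda>x. norm (f x)) \<in> C0"
  by (rule C0_dominated[of f]) (auto intro: continuous_on_norm C0_continuous)

lemma C0_abs: 
  fixes f :: "'a::topological_space \<Rightarrow> real"
  shows "f \<in> C0 \<Longrightarrow> (\<lambda>x. \<bar>f x\<bar>) \<in> C0"
  using C0_norm[of f] by simp

lemma C0_functional:
  assumes "contraction_functional \<phi>" "f \<in> C0" shows "(\<lambda>x. \<phi> (f x)) \<in> C0"
proof (rule C0_dominated[OF assms(2)])
  show "continuous_on UNIV (\<lambda>x. \<phi> (f x))"
    by (rule bounded_linear.continuous_on[OF contraction_functionalD(1)[OF assms(1)] C0_continuous[OF assms(2)]])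
  show "norm (\<phi> (f x)) \<le> norm (f x)" for x using contraction_functionalD(3)[OF assms(1)] by simp
qed

lemma
  fixes f g :: "'a::topological_space \<Rightarrow> real"
  assumes "f \<in> C0" "g \<in> C0"
  shows C0_max: "(\<lambda>x. max (f x) (g x)) \<in> C0" and C0_min: "(\<lambda>x. min (f x) (g x)) \<in> C0"
proof -
  have sum: "(\<lambda>x. \<bar>f x\<bar> + \<bar>g x\<bar>) \<in> C0" using assms by (intro C0_add C0_abs)
  show "(\<lambda>x. max (f x) (g x)) \<in> C0" "(\<lambda>x. min (f x) (g x)) \<in> C0"
    by (rule C0_dominated[OF sum], intro continuous_intros C0_continuous assms, simp)+
qed

lemma C0_bcontfun: "f \<in> C0 \<Longrightarrow> f \<in> bcontfun"
  by (simp add: bcontfun_def C0_continuous C0_bounded)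

lemma bcontfun_add:
  fixes f g :: "'a::topological_space \<Rightarrow> 'b::real_normed_vector"
  shows "f \<in> bcontfun \<Longrightarrow> g \<in> bcontfun \<Longrightarrow> (\<lambda>x. f x + g x) \<in> bcontfun"
  by (auto simp: bcontfun_def intro: continuous_on_add bounded_plus_comp)

section \<open>Bump functions and disjoint neighbourhoods in locally compact Hausdorff
  spaces\<close>

lemma Hausdorff_space_t2_euclidean: "Hausdorff_space (euclidean :: 'k::t2_space topology)"
  unfolding Hausdorff_space_def disjnt_def using hausdorff by fastforce

lemma compact_neighbourhood:
  fixes x :: "'k::t2_space"
  assumes lc: "locally_compact_space (euclidean :: 'k topology)" and W: "open W" "x \<in> W"
  obtains V C where "open V" "compact C" "x \<in> V" "V \<subseteq> C" "C \<subseteq> W"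
proof -
  have "neighbourhood_base_of (compactin (euclidean :: 'k topology)) euclidean"
    using lc locally_compact_space_neighbourhood_base[of "euclidean :: 'k topology"]
      Hausdorff_space_t2_euclidean by blast
  then have "\<exists>V C. open V \<and> compact C \<and> x \<in> V \<and> V \<subseteq> C \<and> C \<subseteq> W"
    using W unfolding neighbourhood_base_of by simp
  then show thesis using that by blast
qed

text \<open>The value 1 on a neighbourhood of \<open>x\<close>, not just at \<open>x\<close>,
  matters twice: multiplying by 1 minus a bump gives a function that vanishes near \<open>x\<close>,
  and a further peak fits below a bump.\<close>

lemma C0_bump:
  fixes x :: "'k::t2_space"
  assumes lc: "locally_compact_space (euclidean :: 'k topology)" and V: "open V" "x \<in> V"
  shows "\<exists>f\<in>C0. (\<forall>t. 0 \<le> f t \<and> f t \<le> (1::real)) \<and> (\<exists>W. open W \<and> x \<in> W \<and> (\<forall>t\<in>W. f t = 1)) \<and>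
    (\<forall>t. t \<notin> V \<longrightarrow> f t = 0)"
proof -
  obtain U C where U: "open U" "compact C" "x \<in> U" "U \<subseteq> C"
    using compact_neighbourhood[OF lc open_UNIV UNIV_I] .
  have "regular_space (euclidean :: 'k topology)"
    using lc locally_compact_Hausdorff_imp_regular_space Hausdorff_space_t2_euclidean by blast
  with lc have "completely_regular_space (euclidean :: 'k topology)"
    using locally_compact_regular_imp_completely_regular_space by blast
  moreover have "closedin euclidean (- (U \<inter> V))" "x \<in> topspace euclidean - (- (U \<inter> V))" using U V by auto
  ultimately obtain h :: "'k \<Rightarrow> real" where h: "continuous_map euclidean euclideanreal h" "h x = 0" "h ` (- (U \<inter> V)) \<subseteq> {1}"
    unfolding completely_regular_space_alt by blast
  have cont: "continuous_on UNIV h" using h(1) by simp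
  \<comment> \<open>Doubling before truncating gives the value 1 on the whole open set
    \<open>h t < 1 / 2\<close>, while \<open>h t = 1\<close> still gives 0.\<close>
  define f where "f t = min 1 (max 0 (2 - 2 * h t))" for t
  have f0: "f t = 0" if "t \<notin> U \<inter> V" for t
  proof -
    have "h t = 1" using h(3) that by blast
    then show ?thesis by (simp add: f_def)
  qed
  have cf: "continuous_on UNIV f" unfolding f_def using cont by (intro continuous_intros)
  have "norm (f t) < e" if "e > 0" "t \<notin> C" for e t
  proof -
    have "t \<notin> U \<inter> V" using that(2) U(4) by blast
    then show ?thesis using f0 that(1) by simp
  qed
  then have "f \<in> C0" using cf U(2) by (auto simp: C0_def vanishes_at_infinity_def)
  moreover have "\<exists>W. open W \<and> x \<in> W \<and> (\<forall>t\<in>W. f t = 1)"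
  proof (intro exI conjI)
    show "open {t. h t < 1 / 2}" by (intro open_Collect_less cont continuous_on_const)
  qed (simp_all add: f_def h(2))
  moreover have "\<forall>t. 0 \<le> f t \<and> f t \<le> 1" by (simp add: f_def)
  ultimately show ?thesis using f0 by blast
qed

text \<open>If all neighbourhoods of some \<open>p\<close> in \<open>W\<close> contain infinitely
  many points of \<open>S\<close>, another point of \<open>S\<close> can be separated from
  \<open>p\<close>, and the side of \<open>p\<close> is kept. Otherwise a compact neighbourhood of a
  point of \<open>S\<close> contains finitely many points of \<open>S\<close>, and deleting it
  leaves infinitely many.\<close>

lemma infinite_split_off_point:
  fixes S W :: "'k::t2_space set"
  assumes lc: "locally_compact_space (euclidean :: 'k topology)" and W: "open W" "infinite (W \<inter> S)"
  shows "\<exists>x V W'. x \<in> S \<and> x \<in> V \<and> open V \<and> V \<subseteq> W \<and> open W' \<and> W' \<subseteq> W \<and> V \<inter> W' = {} \<and> infinite (W' \<inter> S)"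
proof (cases "\<exists>p\<in>W. \<forall>U. open U \<longrightarrow> p \<in> U \<longrightarrow> infinite (U \<inter> S)")
  case True
  then obtain p where p: "p \<in> W" "\<And>U. open U \<Longrightarrow> p \<in> U \<Longrightarrow> infinite (U \<inter> S)" by blast
  have "infinite (W \<inter> S - {p})" using W by simp
  then obtain x where x: "x \<in> W" "x \<in> S" "x \<noteq> p" by (metis Diff_iff IntE finite.emptyI insertI1 ex_in_conv)
  obtain V U where VU: "open V" "open U" "x \<in> V" "p \<in> U" "V \<inter> U = {}" using hausdorff[OF x(3)] by blast
  show ?thesis
  proof (rule exI[of _ x], rule exI[of _ "V \<inter> W"], rule exI[of _ "U \<inter> W"], intro conjI)
    show "infinite (U \<inter> W \<inter> S)" using p VU W by (intro p(2)) auto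
  qed (use x VU W in auto)
next
  case False
  obtain a where a: "a \<in> W" "a \<in> S" using W(2) by (metis IntE finite.emptyI ex_in_conv)
  have fin: "\<exists>U. open U \<and> p \<in> U \<and> finite (U \<inter> S)" if "p \<in> W" for p using False that by blast
  obtain V C where V: "open V" "compact C" "a \<in> V" "V \<subseteq> C" "C \<subseteq> W"
    using compact_neighbourhood[OF lc W(1) a(1)] .
  have "finite (C \<inter> S)"
  proof -
    obtain U where U: "\<And>p. p \<in> W \<Longrightarrow> open (U p)" "\<And>p. p \<in> W \<Longrightarrow> p \<in> U p" "\<And>p. p \<in> W \<Longrightarrow> finite (U p \<inter> S)"
      using fin by metis
    have "\<And>p. p \<in> C \<Longrightarrow> open (U p)" "C \<subseteq> (\<Union>p\<in>C. U p)" using U(1,2) V(5) by blast+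
    then obtain D where D: "D \<subseteq> C" "finite D" "C \<subseteq> (\<Union>p\<in>D. U p)"
      by (rule compactE_image[OF V(2)])
    have "C \<inter> S \<subseteq> (\<Union>p\<in>D. U p \<inter> S)" using D by blast
    moreover have "finite (\<Union>p\<in>D. U p \<inter> S)" using D U(3) V(5) by blast
    ultimately show ?thesis by (rule finite_subset)
  qed
  moreover have "W \<inter> S = (W - C) \<inter> S \<union> C \<inter> S" using V(5) by blast
  ultimately have "infinite ((W - C) \<inter> S)" using W(2) by (metis finite_UnI)
  then show ?thesis
    using a V W(1) compact_imp_closed[OF V(2)]
    by - (rule exI[of _ a], rule exI[of _ V], rule exI[of _ "W - C"], auto)
qed

lemma infinite_disjoint_neighbourhoods:
  fixes S :: "'k::t2_space set"
  assumes lc: "locally_compact_space (euclidean :: 'k topology)" and S: "infinite S"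
  shows "\<exists>(x :: nat \<Rightarrow> 'k) V. (\<forall>n. x n \<in> S \<and> x n \<in> V n \<and> open (V n)) \<and> disjoint_family V"
proof -
  \<comment> \<open>\<open>W\<close> is the reserve: disjoint from \<open>V\<close>, still rich in
    points of \<open>S\<close>, and the place where all later choices are made.\<close>
  define P where "P = (\<lambda>(x, V, W). x \<in> S \<and> x \<in> V \<and> open V \<and> open W \<and> V \<inter> W = {} \<and> infinite (W \<inter> S))"
  have "\<exists>f. \<forall>n. P (f n) \<and> fst (snd (f (Suc n))) \<subseteq> snd (snd (f n)) \<and> snd (snd (f (Suc n))) \<subseteq> snd (snd (f n))"
  proof (rule dependent_nat_choice)
    have "infinite (UNIV \<inter> S)" using S by simp
    from infinite_split_off_point[OF lc open_UNIV this] show "\<exists>s. P s" by (auto simp: P_def)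
  next
    fix s n assume "P s"
    then have "open (snd (snd s))" "infinite (snd (snd s) \<inter> S)" by (auto simp: P_def)
    from infinite_split_off_point[OF lc this] obtain x V W where
      "x \<in> S" "x \<in> V" "open V" "V \<subseteq> snd (snd s)" "open W" "W \<subseteq> snd (snd s)" "V \<inter> W = {}" "infinite (W \<inter> S)"
      by blast
    then show "\<exists>s'. P s' \<and> fst (snd s') \<subseteq> snd (snd s) \<and> snd (snd s') \<subseteq> snd (snd s)"
      by (intro exI[of _ "(x, V, W)"]) (simp add: P_def)
  qed
  then obtain f where f: "\<And>n. P (f n)" "\<And>n. fst (snd (f (Suc n))) \<subseteq> snd (snd (f n))"
    "\<And>n. snd (snd (f (Suc n))) \<subseteq> snd (snd (f n))" by blast
  define V where "V n = fst (snd (f n))" for n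
  define W where "W n = snd (snd (f n))" for n
  have VW: "V n \<inter> W n = {}" "V (Suc n) \<subseteq> W n" "W (Suc n) \<subseteq> W n" for n
    using f[of n] by (auto simp: P_def V_def W_def split: prod.splits)
  have dec: "decseq W" using VW(3) by (rule decseq_SucI)
  have sub: "V n \<subseteq> W m" if mn: "m < n" for m n
  proof -
    obtain k where k: "n = Suc k" "m \<le> k" using mn by (cases n) auto
    then show ?thesis using VW(2)[of k] decseqD[OF dec k(2)] by blast
  qed
  have "V m \<inter> V n = {}" if "m \<noteq> n" for m n
    using sub[of m n] sub[of n m] VW(1)[of m] VW(1)[of n] that by (cases "m < n") auto
  then have "disjoint_family V" by (simp add: disjoint_family_on_def)
  moreover have "\<forall>n. fst (f n) \<in> S \<and> fst (f n) \<in> V n \<and> open (V n)"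
    using f(1) by (simp add: P_def V_def split_beta)
  ultimately show ?thesis by (intro exI[of _ "\<lambda>n. fst (f n)"] exI[of _ V] conjI)
qed

subsection \<open>Positive functionals\<close>

text \<open>The case \<open>c = 0\<close> of \<open>J_le\<close> is positivity; in general it bounds
  \<open>J u\<close> by the supremum of the positive part of \<open>u\<close>. The laws bind
  \<open>J\<close> on bounded continuous functions only.\<close>

locale positive_functional =
  fixes J :: "('l::topological_space \<Rightarrow> real) \<Rightarrow> real"
  assumes J_add: "u \<in> bcontfun \<Longrightarrow> v \<in> bcontfun \<Longrightarrow> J (\<lambda>y. u y + v y) = J u + J v"
    and J_le: "u \<in> bcontfun \<Longrightarrow> 0 \<le> c \<Longrightarrow> (\<And>y. u y \<le> c) \<Longrightarrow> J u \<le> c"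
begin

lemma J_mono:
  assumes u: "u \<in> bcontfun" and v: "v \<in> bcontfun" and le: "\<And>y. u y \<le> v y"
  shows "J u \<le> J v"
proof -
  have *: "(\<lambda>y. u y - v y) \<in> bcontfun"
    using u v by (auto simp: bcontfun_def intro: continuous_on_diff bounded_minus_comp)
  have "J u = J (\<lambda>y. v y + (u y - v y))" by simp
  also have "\<dots> = J v + J (\<lambda>y. u y - v y)" by (rule J_add[OF v *])
  also have "J (\<lambda>y. u y - v y) \<le> 0" by (rule J_le[OF *]) (use le in auto)
  finally show ?thesis by simp
qed

lemma J_le_add_const:
  assumes u: "u \<in> bcontfun" and v: "v \<in> bcontfun" and c: "0 \<le> c" and le: "\<And>y. u y \<le> v y + c"
  shows "J u \<le> J v + c"
proof -
  have cb: "(\<lambda>y. c) \<in> bcontfun" by (rule const_bcontfun)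
  have "J u \<le> J (\<lambda>y. v y + c)" using le by (intro J_mono u bcontfun_add v cb)
  also have "\<dots> = J v + J (\<lambda>y. c)" by (rule J_add[OF v cb])
  also have "J (\<lambda>y. c) \<le> c" using c by (intro J_le cb) auto
  finally show ?thesis by simp
qed

lemma J_zero: "J (\<lambda>y. 0) = 0"
  using J_add[OF const_bcontfun const_bcontfun, of 0 0] by simp

lemma J_sum: "(\<And>i. i \<in> S \<Longrightarrow> u i \<in> C0) \<Longrightarrow> J (\<lambda>y. \<Sum>i\<in>S. u i y) = (\<Sum>i\<in>S. J (u i))"
  by (induction S rule: infinite_finite_induct) (auto simp: J_zero J_add C0_bcontfun C0_sum)

end

primrec running_max :: "(nat \<Rightarrow> 'a \<Rightarrow> real) \<Rightarrow> nat \<Rightarrow> nat \<Rightarrow> 'a \<Rightarrow> real" where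
  "running_max k n 0 = k n"
| "running_max k n (Suc d) = (\<lambda>y. max (running_max k n d y) (k (n + Suc d) y))"

lemma running_max_mono: "d \<le> e \<Longrightarrow> running_max k n d y \<le> running_max k n e y"
  by (rule lift_Suc_mono_le[of "\<lambda>d. running_max k n d y"]) auto

lemma running_max_Suc_le: "running_max k (Suc n) d y \<le> running_max k n (Suc d) y"
  by (induction d) (auto simp: le_max_iff_disj)

lemma running_max_attained: "\<exists>j\<ge>n. running_max k n d y = k j y"
proof (induction d)
  case (Suc d)
  show ?case
  proof (cases "running_max k n d y \<le> k (n + Suc d) y")
    case True
    then show ?thesis by (intro exI[of _ "n + Suc d"]) (simp add: max_absorb2)
  next
    case False
    then show ?thesis using Suc.IH by (simp add: max_absorb1)
  qed
qed auto

lemma running_max_C0: "(\<And>n. k n \<in> C0) \<Longrightarrow> running_max k n d \<in> C0"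
  by (induction d) (auto intro: C0_max)

lemma running_max_bounds:
  assumes "\<And>n. 0 \<le> k n y" "\<And>n. k n y \<le> b"
  shows "0 \<le> running_max k n d y" "running_max k n d y \<le> b"
  using running_max_attained[where k = k and n = n and d = d and y = y] assms by auto

context positive_functional begin

(* A bounded convergence theorem without measures: the minima p n of the almost optimal partial
   maxima M n keep J (p n) bounded below, and their superlevel sets are nested and compact. *)
lemma bounded_convergence:
  assumes k: "\<And>n. k n \<in> C0" and nn: "\<And>n y. 0 \<le> k n y" and kb: "\<And>n y. k n y \<le> b"
    and lim: "\<And>y. (\<lambda>n. k n y) \<longlonglongrightarrow> 0" and e: "0 < e"
  shows "\<exists>n. J (k n) < e"
proof (rule ccontr)
  assume "\<not> (\<exists>n. J (k n) < e)"
  then have big: "\<And>n. e \<le> J (k n)" by (simp add: not_less)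
  let ?m = "running_max k"
  have m_C0: "?m n d \<in> C0" for n d using running_max_C0[of k, OF k] .
  have b0: "0 \<le> b" using nn kb order_trans by blast
  have m_bd: "0 \<le> ?m n d y" "?m n d y \<le> b" for n d y
    using running_max_bounds[of k y b, OF nn kb] by auto
  define g where "g n = (SUP d. J (?m n d))" for n
  have bdd: "bdd_above (range (\<lambda>d. J (?m n d)))" for n
    using m_bd b0 by (intro bdd_aboveI2[of _ _ b] J_le C0_bcontfun m_C0)
  have g_upper: "J (?m n d) \<le> g n" for n d unfolding g_def by (rule cSUP_upper[OF UNIV_I bdd])
  \<comment> \<open>These tolerances add up to \<open>e / 2\<close>, the total loss granted to
    \<open>J (p n)\<close>.\<close>
  have "\<exists>d. g n - e / 2 ^ (n + 2) < J (?m n d)" for n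
  proof -
    have "g n - e / 2 ^ (n + 2) < (SUP d. J (?m n d))" using e by (simp add: g_def)
    then show ?thesis using less_cSUP_iff[OF _ bdd[of n]] by auto
  qed
  then obtain N where N: "\<And>n. g n - e / 2 ^ (n + 2) < J (?m n (N n))" by metis
  define M where "M n = ?m n (N n)" for n
  define p where "p = rec_nat (M 0) (\<lambda>n q y. min (q y) (M (Suc n) y))"
  have p_simps: "p 0 = M 0" "p (Suc n) = (\<lambda>y. min (p n y) (M (Suc n) y))" for n by (simp_all add: p_def)
  have M_C0: "M n \<in> C0" for n by (simp add: M_def m_C0)
  have p_C0: "p n \<in> C0" for n by (induction n) (auto simp: p_simps M_C0 C0_min)
  have p_le_M: "p n y \<le> M n y" for n y by (cases n) (auto simp: p_simps)
  \<comment> \<open>The term \<open>e / 2 ^ (n + 2)\<close> is the sum of the tolerances not yet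
    spent. In the step, minimum plus maximum is the sum, and the maximum of \<open>p n\<close> and
    \<open>M (Suc n)\<close> lies below a running maximum that starts at \<open>n\<close>, so its
    \<open>J\<close> is at most \<open>g n\<close>.\<close>
  have lowp: "g n - e / 2 + e / 2 ^ (n + 2) \<le> J (p n)" for n
  proof (induction n)
    case 0
    then show ?case using N[of 0] by (simp add: p_simps M_def)
  next
    case (Suc n)
    let ?mx = "\<lambda>y. max (p n y) (M (Suc n) y)"
    define d where "d = max (N n) (Suc (N (Suc n)))"
    have mx: "?mx \<in> C0" by (intro C0_max p_C0 M_C0)
    have "?mx y \<le> ?m n d y" for y
      using p_le_M[of n y] running_max_mono[of "N n" d k n y]
        running_max_Suc_le[of k n "N (Suc n)" y] running_max_mono[of "Suc (N (Suc n))" d k n y]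
      by (auto simp: M_def d_def simp del: running_max.simps)
    then have "J ?mx \<le> J (?m n d)" by (intro J_mono C0_bcontfun mx m_C0)
    also have "\<dots> \<le> g n" by (rule g_upper)
    finally have 1: "J ?mx \<le> g n" .
    have "J (p n) + J (M (Suc n)) = J (\<lambda>y. p n y + M (Suc n) y)"
      by (simp add: J_add C0_bcontfun p_C0 M_C0)
    also have "\<dots> = J (\<lambda>y. p (Suc n) y + ?mx y)" by (rule arg_cong[of _ _ J]) (auto simp: p_simps min_def max_def)
    also have "\<dots> = J (p (Suc n)) + J ?mx" by (intro J_add C0_bcontfun p_C0 mx)
    finally have 2: "J (p n) + J (M (Suc n)) = J (p (Suc n)) + J ?mx" .
    have 3: "e / 2 ^ (n + 2) = 2 * (e / 2 ^ (Suc n + 2))" by simp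
    show ?case using 1 2 3 Suc.IH N[of "Suc n"] unfolding M_def by linarith
  qed
  \<comment> \<open>\<open>lowp\<close> and \<open>e \<le> g n\<close> give
    \<open>J (p n) > e / 2\<close>, so \<open>p n\<close> cannot stay below the smaller level
    \<open>e / 4\<close>.\<close>
  define K where "K n = {y. e / 4 \<le> p n y}" for n
  have K_closed: "closed (K n)" for n
    unfolding K_def by (intro closed_Collect_le continuous_on_const C0_continuous p_C0)
  have K_dec: "decseq K" by (intro decseq_SucI) (auto simp: K_def p_simps)
  have K_ne: "K n \<noteq> {}" for n
  proof
    assume "K n = {}"
    then have "\<And>y. p n y \<le> e / 4" by (simp add: K_def not_le less_imp_le)
    then have "J (p n) \<le> e / 4" using e by (intro J_le C0_bcontfun p_C0) auto
    moreover have "e \<le> g n" using big[of n] g_upper[of n 0] by simp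
    moreover have "0 < e / 2 ^ (n + 2)" using e by simp
    ultimately show False using lowp[of n] e by linarith
  qed
  have "e / 4 > 0" using e by simp
  then obtain C where C: "compact C" "\<And>y. y \<notin> C \<Longrightarrow> norm (p 0 y) < e / 4"
    using C0_small_off_compact[OF p_C0] by blast
  have "K 0 \<subseteq> C" using C(2) by (force simp: K_def)
  then have K0: "compact (K 0)" using compact_Int_closed[OF C(1) K_closed[of 0]] by (simp add: Int_absorb1)
  have "K 0 \<inter> (\<Inter>n\<in>UNIV. K n) \<noteq> {}"
  proof (rule compact_imp_fip_image[OF K0 K_closed])
    fix I :: "nat set" assume "finite I"
    then obtain m where "\<And>i. i \<in> I \<Longrightarrow> i \<le> m" using finite_nat_set_iff_bounded_le by auto
    then have "K m \<subseteq> K 0 \<inter> (\<Inter>n\<in>I. K n)" using decseqD[OF K_dec] by blast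
    then show "K 0 \<inter> (\<Inter>n\<in>I. K n) \<noteq> {}" using K_ne[of m] by blast
  qed
  then obtain y where y: "\<And>n. e / 4 \<le> p n y" by (auto simp: K_def)
  \<comment> \<open>\<open>M n\<close> is a maximum over indices from \<open>n\<close> on, so at the
    common point \<open>y\<close> the values \<open>k j y\<close> reach \<open>e / 4\<close> for
    arbitrarily large \<open>j\<close>.\<close>
  have "\<exists>j\<ge>n. e / 4 \<le> k j y" for n
    using running_max_attained[where k = k and n = n and d = "N n" and y = y] y[of n] p_le_M[of n y]
    by (auto simp: M_def)
  moreover have "\<forall>\<^sub>F n in sequentially. k n y < e / 4" using order_tendstoD(2)[OF lim, of "e / 4"] e by simp
  ultimately show False by (meson eventually_sequentially not_less)
qed

end

section \<open>Points of the domain charged by points of the target\<close>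

subsection \<open>Embeddings\<close>

locale C0_embedding =
  fixes T :: "('k::t2_space \<Rightarrow> real) \<Rightarrow> 'l::t2_space \<Rightarrow> 'x::banach" and A B :: real
  assumes locally_compact: "locally_compact_space (euclidean :: 'k topology)"
    and c0_free: "\<not> contains_copy_of_c0 TYPE('x)"
    and T_C0: "f \<in> C0 \<Longrightarrow> T f \<in> C0"
    and T_add: "f \<in> C0 \<Longrightarrow> g \<in> C0 \<Longrightarrow> T (\<lambda>x. f x + g x) = (\<lambda>y. T f y + T g y)"
    and T_scale: "f \<in> C0 \<Longrightarrow> T (\<lambda>x. c *\<^sub>R f x) = (\<lambda>y. c *\<^sub>R T f y)"
    and A_pos: "0 < A" and B_pos: "0 < B"
    and T_lower: "f \<in> C0 \<Longrightarrow> A * supnorm f \<le> supnorm (T f)"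
    and T_upper: "f \<in> C0 \<Longrightarrow> supnorm (T f) \<le> B * supnorm f"
begin

lemma T_zero: "T (\<lambda>x. 0) = (\<lambda>y. 0)"
  using T_scale[OF C0_zero, of 0] by simp

lemma T_diff: "f \<in> C0 \<Longrightarrow> g \<in> C0 \<Longrightarrow> T (\<lambda>x. f x - g x) = (\<lambda>y. T f y - T g y)"
  using T_add[of f "\<lambda>x. (-1) *\<^sub>R g x"] T_scale[of g "-1"] C0_scale[of g "-1"] by simp

lemma T_sum:
  "(\<And>i. i \<in> S \<Longrightarrow> f i \<in> C0) \<Longrightarrow> T (\<lambda>x. \<Sum>i\<in>S. f i x) = (\<lambda>y. \<Sum>i\<in>S. T (f i) y)"
  by (induction S rule: infinite_finite_induct) (simp_all add: T_zero T_add C0_sum)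

lemma norm_T_le:
  assumes f: "f \<in> C0" and le: "\<And>t. \<bar>f t\<bar> \<le> 1"
  shows "norm (T f y) \<le> B"
proof -
  have "norm (T f y) \<le> supnorm (T f)" by (rule norm_le_supnorm[OF T_C0[OF f]])
  also have "\<dots> \<le> B * supnorm f" by (rule T_upper[OF f])
  also have "\<dots> \<le> B * 1" using le B_pos by (intro mult_left_mono supnorm_le) auto
  finally show ?thesis by simp
qed

lemma A_le_norm_T:
  assumes f: "f \<in> C0" and x: "f x = 1" and le: "\<And>y. norm (T f y) \<le> c"
  shows "A \<le> c"
proof -
  have "A * 1 \<le> A * supnorm f" using norm_le_supnorm[OF f, of x] x A_pos by (intro mult_left_mono) auto
  also have "\<dots> \<le> supnorm (T f)" by (rule T_lower[OF f])
  also have "\<dots> \<le> c" by (rule supnorm_le[OF le])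
  finally show ?thesis by simp
qed

text \<open>Signed finite sums of the \<open>d n\<close> stay in the unit ball, so those of the
  vectors \<open>T (d n) y\<close> are bounded by \<open>B\<close>.\<close>

lemma T_null:
  assumes d: "\<And>n. d n \<in> C0" and sum: "\<And>S t. finite S \<Longrightarrow> (\<Sum>n\<in>S. \<bar>d n t\<bar>) \<le> 1"
  shows "(\<lambda>n. T (d n) y) \<longlonglongrightarrow> 0"
proof (rule weakly_summable_imp_null[OF c0_free])
  fix S :: "nat set" and a :: "nat \<Rightarrow> real" assume S: "finite S" and a: "\<And>n. \<bar>a n\<bar> \<le> 1"
  let ?f = "\<lambda>t. \<Sum>n\<in>S. a n *\<^sub>R d n t"
  have "(\<Sum>n\<in>S. a n *\<^sub>R T (d n) y) = T ?f y" by (simp only: T_sum C0_scale T_scale d)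
  also have "norm (T ?f y) \<le> B"
  proof (rule norm_T_le)
    show "?f \<in> C0" by (intro C0_sum C0_scale d)
    fix t
    have "\<bar>?f t\<bar> \<le> (\<Sum>n\<in>S. \<bar>a n *\<^sub>R d n t\<bar>)" by (rule sum_abs)
    also have "\<dots> \<le> (\<Sum>n\<in>S. \<bar>d n t\<bar>)" using a by (intro sum_mono) (simp add: abs_mult mult_left_le_one_le)
    finally show "\<bar>?f t\<bar> \<le> 1" using sum[OF S, of t] by simp
  qed
  finally show "norm (\<Sum>n\<in>S. a n *\<^sub>R T (d n) y) \<le> B" .
qed

lemma T_null_disjoint:
  assumes d: "\<And>n. d n \<in> C0" and le: "\<And>n t. \<bar>d n t\<bar> \<le> 1" and V: "disjoint_family V"
    and off: "\<And>n t. t \<notin> V n \<Longrightarrow> d n t = 0"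
  shows "(\<lambda>n. T (d n) y) \<longlonglongrightarrow> 0"
proof (rule T_null[OF d])
  fix S :: "nat set" and t assume S: "finite S"
  show "(\<Sum>n\<in>S. \<bar>d n t\<bar>) \<le> 1"
  proof (cases "\<exists>m\<in>S. t \<in> V m")
    case True
    then obtain m where m: "m \<in> S" "t \<in> V m" by blast
    have "d n t = 0" if "n \<noteq> m" for n
      using V m(2) that off[of t n] by (auto simp: disjoint_family_on_def)
    then have "(\<Sum>n\<in>S. \<bar>d n t\<bar>) = (\<Sum>n\<in>S. if n = m then \<bar>d m t\<bar> else 0)" by (intro sum.cong) auto
    also have "\<dots> = \<bar>d m t\<bar>" using S m(1) by simp
    finally show ?thesis using le by simp
  next
    case False
    then have "(\<Sum>n\<in>S. \<bar>d n t\<bar>) = 0" using off by (intro sum.neutral) auto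
    then show ?thesis by simp
  qed
qed

(* The operator f \<mapsto> T f y is represented by a vector measure on the domain; charges e y x says
   that the semivariation of this measure at {x} is at least e. *)
definition charges :: "real \<Rightarrow> 'l \<Rightarrow> 'k \<Rightarrow> bool" where
  "charges e y x \<longleftrightarrow> (\<forall>V. open V \<longrightarrow> x \<in> V \<longrightarrow>
     (\<exists>u\<in>C0. (\<forall>t. \<bar>u t\<bar> \<le> 1) \<and> (\<forall>t. t \<notin> V \<longrightarrow> u t = 0) \<and> e \<le> norm (T u y)))"

text \<open>Infinitely many charged points would include a sequence with disjoint neighbourhoods.
  The functions witnessing the charges there have disjoint supports, so their images at
  \<open>y\<close> tend to 0 and cannot keep norm \<open>e\<close>.\<close>

lemma finite_charges: "0 < e \<Longrightarrow> finite {x. charges e y x}"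
proof (rule ccontr)
  assume e: "0 < e" and "infinite {x. charges e y x}"
  from infinite_disjoint_neighbourhoods[OF locally_compact this(2)]
  obtain x V where xV: "\<And>n::nat. charges e y (x n)" "\<And>n. x n \<in> V n" "\<And>n. open (V n)" "disjoint_family V"
    by auto
  have "\<forall>n. \<exists>u\<in>C0. (\<forall>t. \<bar>u t\<bar> \<le> 1) \<and> (\<forall>t. t \<notin> V n \<longrightarrow> u t = 0) \<and> e \<le> norm (T u y)"
    using xV(1-3) unfolding charges_def by blast
  then obtain u where u: "\<And>n. u n \<in> C0" "\<And>n t. \<bar>u n t\<bar> \<le> 1" "\<And>n t. t \<notin> V n \<Longrightarrow> u n t = 0"
    "\<And>n. e \<le> norm (T (u n) y)" by metis
  have "(\<lambda>n. norm (T (u n) y)) \<longlonglongrightarrow> 0"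
    using tendsto_norm_zero[OF T_null_disjoint[OF u(1,2) xV(4) u(3)]] by simp
  then have "e \<le> 0" by (rule LIMSEQ_le_const) (use u(4) in auto)
  with e show False by simp
qed

lemma countable_charges: "countable {x. \<exists>e>0. charges e y x}"
proof -
  have "{x. \<exists>e>0. charges e y x} \<subseteq> (\<Union>n. {x. charges (inverse (real (Suc n))) y x})"
  proof
    fix x assume "x \<in> {x. \<exists>e>0. charges e y x}"
    then obtain e where e: "e > 0" "charges e y x" by blast
    obtain n where "inverse (real (Suc n)) < e" using reals_Archimedean[OF e(1)] by blast
    then have "charges (inverse (real (Suc n))) y x"
      using e(2) unfolding charges_def by (meson less_imp_le order_trans)
    then show "x \<in> (\<Union>n. {x. charges (inverse (real (Suc n))) y x})" by blast
  qed
  moreover have "countable (\<Union>n. {x. charges (inverse (real (Suc n))) y x})"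
    by (rule countable_UN[OF countableI_type countable_finite[OF finite_charges]]) simp
  ultimately show ?thesis by (rule countable_subset)
qed

text \<open>On a finite target, pointwise convergence is uniform, so disjointly supported bumps
  contradict the lower bound \<open>A\<close>. Countably many charged points for each
  \<open>y\<close> would not give finiteness.\<close>

lemma finite_domain:
  assumes "finite (UNIV :: 'l set)" shows "finite (UNIV :: 'k set)"
proof (rule ccontr)
  assume "infinite (UNIV :: 'k set)"
  from infinite_disjoint_neighbourhoods[OF locally_compact this]
  obtain x :: "nat \<Rightarrow> 'k" and V where xV: "\<And>n. x n \<in> V n" "\<And>n. open (V n)" "disjoint_family V" by auto
  have "\<exists>f. f \<in> C0 \<and> (\<forall>t. \<bar>f t\<bar> \<le> 1) \<and> f (x n) = (1::real) \<and> (\<forall>t. t \<notin> V n \<longrightarrow> f t = 0)" for n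
    using C0_bump[OF locally_compact xV(2) xV(1), of n] by (metis abs_of_nonneg)
  then obtain u :: "nat \<Rightarrow> 'k \<Rightarrow> real" where u: "\<And>n. u n \<in> C0" "\<And>n t. \<bar>u n t\<bar> \<le> 1" "\<And>n. u n (x n) = 1"
    "\<And>n t. t \<notin> V n \<Longrightarrow> u n t = 0" by metis
  have "(\<lambda>n. norm (T (u n) y)) \<longlonglongrightarrow> 0" for y
    using tendsto_norm_zero[OF T_null_disjoint[OF u(1,2) xV(3) u(4)]] by simp
  then have "\<forall>\<^sub>F n in sequentially. norm (T (u n) y) < A / 2" for y
    using A_pos by (intro order_tendstoD(2)) auto
  then have "\<forall>\<^sub>F n in sequentially. \<forall>y\<in>UNIV. norm (T (u n) y) < A / 2"
    by (intro eventually_ball_finite assms) auto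
  then obtain n where "\<And>y. norm (T (u n) y) < A / 2" by (auto simp: eventually_sequentially)
  then have "A \<le> A / 2" by (intro A_le_norm_T[OF u(1,3)] less_imp_le)
  then show False using A_pos by simp
qed

section \<open>A positive functional carrying the lower bound of the embedding\<close>

lemma exists_positive_functional:
  "\<exists>J. positive_functional J \<and> (\<forall>f\<in>C0. f x = 1 \<longrightarrow> A \<le> J (\<lambda>y. norm (T f y)))"
proof -
  \<comment> \<open>With the positive part, \<open>p\<close> vanishes on functions that are at most
    0, so each linear functional below \<open>p\<close> is positive.\<close>
  define p :: "('l \<Rightarrow>\<^sub>C real) \<Rightarrow> real" where "p w = (SUP y. max 0 (w y))" for w
  have bdd: "bdd_above (range (\<lambda>y. max 0 (w y)))" for w :: "'l \<Rightarrow>\<^sub>C real"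
  proof -
    obtain b where "\<And>y. \<bar>w y\<bar> \<le> b"
      using bounded_apply_bcontfun[of w] unfolding bounded_iff by auto
    then have "max 0 (w y) \<le> max 0 b" for y by (meson abs_le_D1 max.mono order_refl)
    then show ?thesis by (intro bdd_aboveI2)
  qed
  have p_upper: "w y \<le> p w" "0 \<le> p w" for y and w :: "'l \<Rightarrow>\<^sub>C real"
    using cSUP_upper[OF UNIV_I bdd, of w y] by (simp_all add: p_def)
  have p_least: "p w \<le> c" if "0 \<le> c" "\<And>y. w y \<le> c" for c and w :: "'l \<Rightarrow>\<^sub>C real"
    unfolding p_def using that by (intro cSUP_least) auto
  have "sublinear p"
  proof (rule sublinearI)
    show "p (u + v) \<le> p u + p v" for u v
      using p_upper[of u] p_upper[of v] by (intro p_least) (auto intro: add_mono)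
    show "p (c *\<^sub>R u) \<le> c * p u" if "0 < c" for c u
      using p_upper[of u] that by (intro p_least) (auto intro: mult_left_mono)
    show "p 0 = 0" using p_upper(2)[of 0] p_least[of 0 0] by simp
  qed
  define D where "D = {d :: 'l \<Rightarrow>\<^sub>C real. \<exists>f\<in>C0. f x = 1 \<and> (\<forall>y. norm (T f y) \<le> d y)}"
  have D_ne: "Bcontfun (\<lambda>y. norm (T f y)) \<in> D" if "f \<in> C0" "f x = 1" for f
  proof -
    have "(\<lambda>y. norm (T f y)) \<in> bcontfun" using that by (intro C0_bcontfun C0_norm T_C0)
    then show ?thesis using that by (auto simp: D_def Bcontfun_inverse)
  qed
  have "convex D"
  proof (rule convexI)
    fix c d and s t :: real
    assume cd: "c \<in> D" "d \<in> D" and st: "0 \<le> s" "0 \<le> t" "s + t = 1"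
    obtain f where f: "f \<in> C0" "f x = 1" "\<And>y. norm (T f y) \<le> c y" using cd by (auto simp: D_def)
    obtain g where g: "g \<in> C0" "g x = 1" "\<And>y. norm (T g y) \<le> d y" using cd by (auto simp: D_def)
    let ?h = "\<lambda>t'. s *\<^sub>R f t' + t *\<^sub>R g t'"
    have h: "?h \<in> C0" using f g by (intro C0_add C0_scale)
    have "norm (T ?h y) \<le> (s *\<^sub>R c + t *\<^sub>R d) y" for y
    proof -
      have "T ?h y = s *\<^sub>R T f y + t *\<^sub>R T g y" using f g by (simp only: T_add C0_scale T_scale)
      also have "norm \<dots> \<le> s * norm (T f y) + t * norm (T g y)"
        using norm_triangle_ineq[of "s *\<^sub>R T f y" "t *\<^sub>R T g y"] st by simp
      also have "\<dots> \<le> s * c y + t * d y" using f g st by (intro add_mono mult_left_mono)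
      finally show ?thesis by simp
    qed
    then show "s *\<^sub>R c + t *\<^sub>R d \<in> D" unfolding D_def using h f g st by (intro CollectI bexI[of _ ?h]) auto
  qed
  moreover obtain f0 :: "'k \<Rightarrow> real" where "f0 \<in> C0" "f0 x = 1"
    using C0_bump[OF locally_compact open_UNIV UNIV_I, of x] by blast
  then have "D \<noteq> {}" using D_ne by blast
  moreover have "A \<le> p d" if dD: "d \<in> D" for d
  proof -
    obtain f where f: "f \<in> C0" "f x = 1" "\<And>y. norm (T f y) \<le> d y" using dD by (auto simp: D_def)
    show ?thesis using f(3) p_upper(1)[of d] by (intro A_le_norm_T[OF f(1,2)]) (rule order_trans)
  qed
  ultimately obtain F where F: "linear F" "\<And>w. F w \<le> p w" "\<And>d. d \<in> D \<Longrightarrow> A \<le> F d"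
    using mazur_orlicz[OF \<open>sublinear p\<close>, of D A] by blast
  let ?J = "\<lambda>w. F (Bcontfun w)"
  have "positive_functional ?J"
  proof
    fix u v :: "'l \<Rightarrow> real" assume uv: "u \<in> bcontfun" "v \<in> bcontfun"
    have "Bcontfun (\<lambda>y. u y + v y) = Bcontfun u + Bcontfun v"
      by (rule bcontfun_eqI) (simp add: Bcontfun_inverse uv bcontfun_add)
    then show "?J (\<lambda>y. u y + v y) = ?J u + ?J v" by (simp add: linear_add[OF F(1)])
  next
    fix u :: "'l \<Rightarrow> real" and c :: real
    assume u: "u \<in> bcontfun" "0 \<le> c" "\<And>y. u y \<le> c"
    then have "p (Bcontfun u) \<le> c" by (intro p_least) (simp_all add: Bcontfun_inverse)
    then show "?J u \<le> c" using F(2) order_trans by blast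
  qed
  moreover have "\<forall>f\<in>C0. f x = 1 \<longrightarrow> A \<le> ?J (\<lambda>y. norm (T f y))" using D_ne F(3) by blast
  ultimately show ?thesis by (intro exI[of _ ?J] conjI)
qed

section \<open>The maximality argument for a single functional\<close>

definition ball_vanishing_near :: "'k \<Rightarrow> ('k \<Rightarrow> real) set" where
  "ball_vanishing_near x = {f \<in> C0. (\<forall>t. \<bar>f t\<bar> \<le> 1) \<and> (\<exists>V. open V \<and> x \<in> V \<and> (\<forall>t\<in>V. f t = 0))}"

lemma zero_ball_vanishing_near: "(\<lambda>t. 0) \<in> ball_vanishing_near x"
  by (auto simp: ball_vanishing_near_def C0_zero intro: exI[of _ UNIV])

text \<open>The maximum includes 0, which is \<open>\<phi> (T f y)\<close> for the zero function
  \<open>f\<close>. As that function lies in \<open>ball_vanishing_near x\<close>, the maximum is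
  attained within this set whenever \<open>fs\<close> is taken from it.\<close>

primrec envelope :: "('x \<Rightarrow> real) \<Rightarrow> ('k \<Rightarrow> real) list \<Rightarrow> 'l \<Rightarrow> real" where
  "envelope \<phi> [] = (\<lambda>y. 0)"
| "envelope \<phi> (f # fs) = (\<lambda>y. max (\<phi> (T f y)) (envelope \<phi> fs y))"

lemma envelope_C0:
  "contraction_functional \<phi> \<Longrightarrow> set fs \<subseteq> C0 \<Longrightarrow> envelope \<phi> fs \<in> C0"
  by (induction fs) (simp_all add: C0_zero C0_max C0_functional T_C0)

lemma envelope_upper: "f \<in> set fs \<Longrightarrow> \<phi> (T f y) \<le> envelope \<phi> fs y"
  by (induction fs) (auto simp: le_max_iff_disj)

lemma envelope_nonneg: "0 \<le> envelope \<phi> fs y"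
  by (induction fs) (auto simp: le_max_iff_disj)

lemma envelope_attained:
  assumes "contraction_functional \<phi>"
  shows "\<exists>f\<in>insert (\<lambda>t. 0) (set fs). \<phi> (T f y) = envelope \<phi> fs y"
proof (induction fs)
  case Nil
  show ?case by (simp add: T_zero linear_0[OF contraction_functionalD(2)[OF assms]])
next
  case (Cons f fs)
  then show ?case by (cases "\<phi> (T f y) \<le> envelope \<phi> fs y") (auto simp: max_absorb1 max_absorb2)
qed

lemma ball_vanishing_near_common:
  "set fs \<subseteq> ball_vanishing_near x \<Longrightarrow> \<exists>U. open U \<and> x \<in> U \<and> (\<forall>f\<in>set fs. \<forall>t\<in>U. f t = 0)"
proof (induction fs)
  case Nil
  show ?case by (rule exI[of _ UNIV]) simp
next
  case (Cons f fs)
  then obtain U where "open U" "x \<in> U" "\<forall>f\<in>set fs. \<forall>t\<in>U. f t = 0" by auto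
  moreover obtain V where "open V" "x \<in> V" "\<forall>t\<in>V. f t = 0" using Cons.prems by (auto simp: ball_vanishing_near_def)
  ultimately show ?case by (intro exI[of _ "U \<inter> V"]) auto
qed

text \<open>Let \<open>fs\<close> nearly maximise \<open>J\<close> of the envelope and let all its
  members vanish on \<open>U\<close>. If \<open>f\<close> is supported in \<open>U\<close> and
  \<open>g\<close> in \<open>fs\<close> attains the envelope at \<open>y\<close>, then
  \<open>g\<close> plus or minus \<open>f\<close> is in the unit ball and raises the value at
  \<open>y\<close> by \<open>\<bar>\<phi> (T f y)\<bar>\<close>. It need not vanish near
  \<open>x\<close>, so a piece of \<open>f\<close> near \<open>x\<close> is cut off, at small cost
  since \<open>y\<close> does not charge \<open>x\<close>. The cut depends on \<open>y\<close>;
  compactness leaves finitely many.\<close>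

lemma uncharged_functional_small:
  assumes J: "positive_functional J" and phi: "contraction_functional \<phi>" and e: "0 < e"
    and un: "\<And>y e. 0 < e \<Longrightarrow> \<not> charges e y x"
  shows "\<exists>U. open U \<and> x \<in> U \<and>
    (\<forall>f\<in>C0. (\<forall>t. \<bar>f t\<bar> \<le> 1) \<longrightarrow> (\<forall>t. t \<notin> U \<longrightarrow> f t = 0) \<longrightarrow> J (\<lambda>y. \<bar>\<phi> (T f y)\<bar>) \<le> e)"
proof -
  interpret positive_functional J by (rule J)
  note lin = contraction_functionalD(2)[OF phi] and phi_le = contraction_functionalD(3)[OF phi]
  let ?L = "{fs. set fs \<subseteq> ball_vanishing_near x}"
  have W_C0: "envelope \<phi> fs \<in> C0" if "fs \<in> ?L" for fs
    using that by (intro envelope_C0 phi) (auto simp: ball_vanishing_near_def)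
  have W_le: "envelope \<phi> fs y \<le> B" if fs: "fs \<in> ?L" for fs y
  proof -
    obtain f where f: "f \<in> insert (\<lambda>t. 0) (set fs)" "\<phi> (T f y) = envelope \<phi> fs y"
      using envelope_attained[OF phi] by blast
    then have "f \<in> ball_vanishing_near x" using fs zero_ball_vanishing_near by blast
    then have "norm (T f y) \<le> B" by (intro norm_T_le) (auto simp: ball_vanishing_near_def)
    then show ?thesis using f(2) phi_le[of "T f y"] by simp
  qed
  have "bdd_above ((\<lambda>fs. J (envelope \<phi> fs)) ` ?L)"
    using W_le W_C0 B_pos by (intro bdd_aboveI2[of _ _ B] J_le C0_bcontfun) auto
  note J_upper = cSUP_upper[OF _ this]
  define s where "s = (SUP fs\<in>?L. J (envelope \<phi> fs))"
  have "\<exists>fs\<in>?L. s - e / 2 < J (envelope \<phi> fs)"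
  proof (rule ccontr)
    assume "\<not> (\<exists>fs\<in>?L. s - e / 2 < J (envelope \<phi> fs))"
    then have "s \<le> s - e / 2" unfolding s_def by (intro cSUP_least) (auto simp: not_less intro: exI[of _ "[]"])
    then show False using e by simp
  qed
  then obtain fs where fs: "fs \<in> ?L" "s - e / 2 < J (envelope \<phi> fs)" by blast
  obtain U where U: "open U" "x \<in> U" "\<And>f t. f \<in> set fs \<Longrightarrow> t \<in> U \<Longrightarrow> f t = 0"
    using ball_vanishing_near_common[of fs x] fs(1) by blast
  have "J (\<lambda>y. \<bar>\<phi> (T f y)\<bar>) \<le> e"
    if f: "f \<in> C0" "\<And>t. \<bar>f t\<bar> \<le> 1" "\<And>t. t \<notin> U \<Longrightarrow> f t = 0" for f
  proof -
    have phi_C0: "(\<lambda>y. \<phi> (T g y)) \<in> C0" if "g \<in> C0" for g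
      by (rule C0_functional[OF phi T_C0[OF that]])
    define w where "w y = envelope \<phi> fs y + \<bar>\<phi> (T f y)\<bar>" for y
    have w_C0: "w \<in> C0" unfolding w_def by (intro C0_add W_C0 fs C0_abs phi_C0 f)
    have local: "\<exists>h\<in>ball_vanishing_near x. w y - e / 2 < \<phi> (T h y)" for y
    proof -
      obtain g where g: "g \<in> insert (\<lambda>t. 0) (set fs)" "\<phi> (T g y) = envelope \<phi> fs y"
        using envelope_attained[OF phi] by blast
      have gb: "g \<in> ball_vanishing_near x" using g(1) fs(1) zero_ball_vanishing_near by blast
      then obtain V where V: "open V" "x \<in> V" "\<And>t. t \<in> V \<Longrightarrow> g t = 0" and g': "g \<in> C0" "\<And>t. \<bar>g t\<bar> \<le> 1"
        by (auto simp: ball_vanishing_near_def)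
      have gU: "g t = 0" if "t \<in> U" for t using g(1) U(3) that by auto
      \<comment> \<open>The sign under which adding \<open>f\<close> contributes the absolute
        value.\<close>
      define r where "r = (if 0 \<le> \<phi> (T f y) then 1 else - 1 :: real)"
      have r: "\<bar>r\<bar> = 1" "r * \<phi> (T f y) = \<bar>\<phi> (T f y)\<bar>" by (auto simp: r_def)
      have "\<not> charges (e / 4) y x" using un e by simp
      then obtain N where N: "open N" "x \<in> N"
        "\<And>u. u \<in> C0 \<Longrightarrow> (\<And>t. \<bar>u t\<bar> \<le> 1) \<Longrightarrow> (\<And>t. t \<notin> N \<Longrightarrow> u t = 0) \<Longrightarrow> norm (T u y) < e / 4"
        unfolding charges_def by (metis not_le)
      obtain c M where c: "c \<in> C0" "\<And>t. 0 \<le> c t \<and> c t \<le> (1::real)" "\<And>t. t \<notin> N \<Longrightarrow> c t = 0"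
        and M: "open M" "x \<in> M" "\<And>t. t \<in> M \<Longrightarrow> c t = 1"
        using C0_bump[OF locally_compact N(1,2)] by blast
      let ?fc = "\<lambda>t. f t * c t"
      have fc_le: "\<bar>?fc t\<bar> \<le> \<bar>f t\<bar>" for t using c(2)[of t] by (simp add: abs_mult mult_right_le_one_le)
      have fc: "?fc \<in> C0"
      proof (rule C0_dominated[OF f(1)])
        show "continuous_on UNIV ?fc" by (intro continuous_on_mult C0_continuous f(1) c(1))
        show "norm (?fc t) \<le> norm (f t)" for t using fc_le[of t] by simp
      qed
      have small: "norm (T ?fc y) < e / 4"
      proof (rule N(3)[OF fc])
        show "\<bar>?fc t\<bar> \<le> 1" for t using fc_le[of t] f(2)[of t] by linarith
      qed (use c(3) in simp)
      \<comment> \<open>\<open>g\<close> vanishes on \<open>U\<close> and \<open>f\<close> off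
        \<open>U\<close>, which keeps \<open>h\<close> in the unit ball; \<open>c = 1\<close> near
        \<open>x\<close> makes \<open>h\<close> vanish there.\<close>
      define h where "h t = g t + r *\<^sub>R (f t - ?fc t)" for t
      have h_C0: "h \<in> C0" unfolding h_def by (intro C0_add C0_scale C0_diff g' f fc)
      have "\<bar>h t\<bar> \<le> 1" for t
      proof (cases "t \<in> U")
        case True
        have "\<bar>h t\<bar> = \<bar>f t\<bar> * (1 - c t)"
        proof -
          have "h t = r * (f t * (1 - c t))" using gU[OF True] by (simp add: h_def algebra_simps)
          then show ?thesis using r(1) c(2)[of t] by (simp add: abs_mult)
        qed
        also have "\<dots> \<le> 1" using f(2)[of t] c(2)[of t] by (intro mult_le_one) auto
        finally show ?thesis .
      next
        case False
        then show ?thesis using f(3) g'(2) by (simp add: h_def)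
      qed
      moreover have "\<forall>t\<in>V \<inter> M. h t = 0" using V(3) M(3) by (simp add: h_def)
      ultimately have hb: "h \<in> ball_vanishing_near x"
        using h_C0 V M unfolding ball_vanishing_near_def by (auto intro!: exI[of _ "V \<inter> M"])
      have "T h y = T g y + r *\<^sub>R (T f y - T ?fc y)"
        unfolding h_def using g'(1) f(1) fc by (simp only: T_add T_scale T_diff C0_diff C0_scale)
      then have "\<phi> (T h y) = \<phi> (T g y) + r * (\<phi> (T f y) - \<phi> (T ?fc y))"
        by (simp only: linear_add[OF lin] linear_cmul[OF lin] linear_diff[OF lin] real_scaleR_def)
      also have "\<dots> = w y - r * \<phi> (T ?fc y)"
        unfolding w_def g(2) right_diff_distrib r(2) by simp
      finally have "\<phi> (T h y) = w y - r * \<phi> (T ?fc y)" .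
      moreover have "\<bar>r * \<phi> (T ?fc y)\<bar> < e / 4"
        using phi_le[of "T ?fc y"] small r(1) by (simp add: abs_mult)
      ultimately have "w y - e / 2 < \<phi> (T h y)" using e by linarith
      then show ?thesis using hb by blast
    qed
    then obtain h where h: "\<And>y. h y \<in> ball_vanishing_near x" "\<And>y. w y - e / 2 < \<phi> (T (h y) y)" by metis
    have h_C0: "h y \<in> C0" for y using h(1)[of y] by (simp add: ball_vanishing_near_def)
    \<comment> \<open>Off \<open>C\<close> there is nothing to cover: \<open>w\<close> is below
      \<open>e / 2\<close> and envelopes are nonnegative.\<close>
    obtain C where C: "compact C" "\<And>y. y \<notin> C \<Longrightarrow> norm (w y) < e / 2"
      using C0_small_off_compact[OF w_C0, of "e / 2"] e by auto
    let ?O = "\<lambda>y. {z. w z - e / 2 < \<phi> (T (h y) z)}"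
    have "open (?O y)" for y
      by (intro open_Collect_less continuous_on_diff continuous_on_const C0_continuous w_C0 phi_C0 h_C0)
    moreover have "C \<subseteq> (\<Union>y\<in>C. ?O y)" using h(2) by blast
    ultimately obtain D where D: "D \<subseteq> C" "finite D" "C \<subseteq> (\<Union>y\<in>D. ?O y)"
      by (rule compactE_image[OF C(1)])
    obtain gs where gs: "set gs = h ` D" using finite_list[of "h ` D"] D(2) by blast
    have gsL: "gs \<in> ?L" using gs h(1) by auto
    have cover: "w z \<le> envelope \<phi> gs z + e / 2" for z
    proof (cases "z \<in> C")
      case True
      then obtain y where y: "y \<in> D" "w z - e / 2 < \<phi> (T (h y) z)" using D(3) by blast
      then show ?thesis using envelope_upper[of "h y" gs \<phi> z] gs by simp
    next
      case False
      then show ?thesis using C(2)[of z] envelope_nonneg[of \<phi> gs z] by simp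
    qed
    \<comment> \<open>The left side exceeds the wanted term by more than \<open>s - e / 2\<close>,
      and the right side turns out to be at most \<open>s + e / 2\<close>.\<close>
    have "J (envelope \<phi> fs) + J (\<lambda>y. \<bar>\<phi> (T f y)\<bar>) = J w"
      unfolding w_def by (intro J_add[symmetric] C0_bcontfun W_C0 fs C0_abs phi_C0 f)
    also have "\<dots> \<le> J (envelope \<phi> gs) + e / 2"
      using e cover by (intro J_le_add_const C0_bcontfun w_C0 W_C0 gsL) auto
    also have "J (envelope \<phi> gs) \<le> s" unfolding s_def by (rule J_upper[OF gsL])
    finally show ?thesis using fs(2) by simp
  qed
  then show ?thesis using U(1,2) by blast
qed

section \<open>Decreasing peaks at an uncharged point\<close>

definition peaking :: "'k \<Rightarrow> ('k \<Rightarrow> real) \<Rightarrow> bool" where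
  "peaking x f \<longleftrightarrow> f \<in> C0 \<and> (\<forall>t. 0 \<le> f t \<and> f t \<le> 1) \<and> (\<exists>V. open V \<and> x \<in> V \<and> (\<forall>t\<in>V. f t = 1))"

text \<open>A functional norming \<open>h y\<close> norms \<open>h\<close> up to \<open>e\<close>
  near \<open>y\<close>, and compactness leaves finitely many. Off \<open>C\<close> the error
  \<open>e\<close> alone exceeds the norm.\<close>

lemma finite_norming_family:
  assumes h: "h \<in> (C0 :: ('l \<Rightarrow> 'x) set)" and e: "0 < e"
  obtains \<Phi> where "finite \<Phi>" "\<And>\<phi>. \<phi> \<in> \<Phi> \<Longrightarrow> contraction_functional \<phi>"
    "\<And>y. \<exists>\<phi>\<in>\<Phi>. norm (h y) \<le> \<bar>\<phi> (h y)\<bar> + e"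
proof -
  have "\<exists>\<phi>. contraction_functional \<phi> \<and> \<phi> (h y) = norm (h y)" for y using norming_functional by blast
  then obtain \<phi> where phi: "\<And>y. contraction_functional (\<phi> y)" "\<And>y. \<phi> y (h y) = norm (h y)" by metis
  obtain C where C: "compact C" "\<And>y. y \<notin> C \<Longrightarrow> norm (h y) < e" using C0_small_off_compact[OF h e] by blast
  let ?O = "\<lambda>y. {z. norm (h z) < \<bar>\<phi> y (h z)\<bar> + e}"
  have "(\<lambda>z. \<bar>\<phi> y (h z)\<bar>) \<in> C0" for y by (rule C0_abs[OF C0_functional[OF phi(1) h]])
  then have "open (?O y)" for y
    by (intro open_Collect_less continuous_on_add continuous_on_const C0_continuous C0_norm h)
  moreover have "z \<in> ?O z" for z using phi(2)[of z] e by simp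
  then have "C \<subseteq> (\<Union>y\<in>C. ?O y)" by blast
  ultimately obtain D where D: "D \<subseteq> C" "finite D" "C \<subseteq> (\<Union>y\<in>D. ?O y)"
    by (rule compactE_image[OF C(1)])
  show thesis
  \<comment> \<open>The index \<open>undefined\<close> keeps the family nonempty when
    \<open>D\<close> is empty; off \<open>C\<close> any member will do.\<close>
  proof (rule that[of "\<phi> ` insert undefined D"])
    show "\<exists>\<psi>\<in>\<phi> ` insert undefined D. norm (h z) \<le> \<bar>\<psi> (h z)\<bar> + e" for z
    proof (cases "z \<in> C")
      case True
      then obtain y where "y \<in> D" "norm (h z) < \<bar>\<phi> y (h z)\<bar> + e" using D(3) by blast
      then show ?thesis by (intro bexI[of _ "\<phi> y"]) auto
    next
      case False
      then have "norm (h z) \<le> \<bar>\<phi> undefined (h z)\<bar> + e" using C(2)[of z] by linarith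
      then show ?thesis by blast
    qed
  qed (use D(2) phi(1) in auto)
qed

text \<open>The family \<open>\<Phi>\<close> is chosen for \<open>T f\<close> alone, so it precedes
  \<open>f'\<close>, which can then be supported where all its members are small under
  \<open>J\<close>. A functional nearly norming \<open>T f y\<close> splits into its values at
  \<open>T f y - T f' y\<close> and at \<open>T f' y\<close>.\<close>

lemma uncharged_refine_peak:
  assumes J: "positive_functional J" and J_lower: "\<And>f. f \<in> C0 \<Longrightarrow> f x = 1 \<Longrightarrow> A \<le> J (\<lambda>y. norm (T f y))"
    and un: "\<And>y e. 0 < e \<Longrightarrow> \<not> charges e y x" and f: "peaking x f"
  shows "\<exists>f'. peaking x f' \<and> (\<forall>t. f' t \<le> f t) \<and> A / 2 \<le> J (\<lambda>y. norm (T f y - T f' y))"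
proof -
  interpret positive_functional J by (rule J)
  obtain V where V: "open V" "x \<in> V" "\<And>t. t \<in> V \<Longrightarrow> f t = 1" and fC: "f \<in> C0" and f01: "\<And>t. 0 \<le> f t \<and> f t \<le> 1"
    using f by (auto simp: peaking_def)
  have A4: "0 < A / 4" using A_pos by simp
  obtain \<Phi> where Phi: "finite \<Phi>" "\<And>\<phi>. \<phi> \<in> \<Phi> \<Longrightarrow> contraction_functional \<phi>"
    "\<And>y. \<exists>\<phi>\<in>\<Phi>. norm (T f y) \<le> \<bar>\<phi> (T f y)\<bar> + A / 4"
    using finite_norming_family[OF T_C0[OF fC] A4] by blast
  have "\<Phi> \<noteq> {}" using Phi(3) by blast
  then have card: "0 < real (card \<Phi>)" using Phi(1) by (simp add: card_gt_0_iff)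
  \<comment> \<open>All members of \<open>\<Phi>\<close> together may contribute
    \<open>A / 4\<close>.\<close>
  define e where "e = A / 4 / real (card \<Phi>)"
  have e: "0 < e" using A4 card by (simp add: e_def)
  have "\<exists>U. open U \<and> x \<in> U \<and>
    (\<forall>f\<in>C0. (\<forall>t. \<bar>f t\<bar> \<le> 1) \<longrightarrow> (\<forall>t. t \<notin> U \<longrightarrow> f t = 0) \<longrightarrow> J (\<lambda>y. \<bar>\<phi> (T f y)\<bar>) \<le> e)"
    if "\<phi> \<in> \<Phi>" for \<phi>
    by (rule uncharged_functional_small[OF J Phi(2)[OF that] e un])
  then obtain U where U: "\<And>\<phi>. \<phi> \<in> \<Phi> \<Longrightarrow> open (U \<phi>)" "\<And>\<phi>. \<phi> \<in> \<Phi> \<Longrightarrow> x \<in> U \<phi>"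
    "\<And>\<phi> f. \<phi> \<in> \<Phi> \<Longrightarrow> f \<in> C0 \<Longrightarrow> (\<And>t. \<bar>f t\<bar> \<le> 1) \<Longrightarrow> (\<And>t. t \<notin> U \<phi> \<Longrightarrow> f t = 0) \<Longrightarrow>
       J (\<lambda>y. \<bar>\<phi> (T f y)\<bar>) \<le> e" by metis
  have "open (V \<inter> (\<Inter>\<phi>\<in>\<Phi>. U \<phi>))" "x \<in> V \<inter> (\<Inter>\<phi>\<in>\<Phi>. U \<phi>)"
    using V U Phi(1) by (auto intro!: open_Int open_INT)
  from C0_bump[OF locally_compact this]
  obtain f' :: "'k \<Rightarrow> real" and W where f': "f' \<in> C0" "\<And>t. 0 \<le> f' t \<and> f' t \<le> 1" "\<And>t. t \<notin> V \<inter> (\<Inter>\<phi>\<in>\<Phi>. U \<phi>) \<Longrightarrow> f' t = 0"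
    and W: "open W" "x \<in> W" "\<forall>t\<in>W. f' t = 1" by blast
  have "peaking x f'" using f' W by (auto simp: peaking_def)
  \<comment> \<open>\<open>f'\<close> is supported in \<open>V\<close>, where \<open>f\<close> is
    1.\<close>
  moreover have "f' t \<le> f t" for t
    using f01[of t] f'(2,3)[of t] V(3)[of t] by (cases "t \<in> V") auto
  moreover have "A / 2 \<le> J (\<lambda>y. norm (T f y - T f' y))"
  proof -
    have TfC: "T f \<in> C0" and Tf'C: "T f' \<in> C0" using fC f' by (simp_all add: T_C0)
    have dC: "(\<lambda>y. norm (T f y - T f' y)) \<in> C0" by (intro C0_norm C0_diff TfC Tf'C)
    have absC: "(\<lambda>y. \<bar>\<phi> (T f' y)\<bar>) \<in> C0" if "\<phi> \<in> \<Phi>" for \<phi>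
      by (rule C0_abs[OF C0_functional[OF Phi(2)[OF that] Tf'C]])
    have sC: "(\<lambda>y. \<Sum>\<phi>\<in>\<Phi>. \<bar>\<phi> (T f' y)\<bar>) \<in> C0" by (rule C0_sum[OF absC])
    have pw: "norm (T f y) \<le> (norm (T f y - T f' y) + (\<Sum>\<phi>\<in>\<Phi>. \<bar>\<phi> (T f' y)\<bar>)) + A / 4" for y
    proof -
      obtain \<phi> where phi: "\<phi> \<in> \<Phi>" "norm (T f y) \<le> \<bar>\<phi> (T f y)\<bar> + A / 4" using Phi(3) by blast
      have "\<phi> (T f y) = \<phi> (T f y - T f' y) + \<phi> (T f' y)"
        by (simp add: linear_diff[OF contraction_functionalD(2)[OF Phi(2)[OF phi(1)]]])
      then have "\<bar>\<phi> (T f y)\<bar> \<le> norm (T f y - T f' y) + \<bar>\<phi> (T f' y)\<bar>"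
        using contraction_functionalD(3)[OF Phi(2)[OF phi(1)], of "T f y - T f' y"] by linarith
      moreover have "\<bar>\<phi> (T f' y)\<bar> \<le> (\<Sum>\<phi>\<in>\<Phi>. \<bar>\<phi> (T f' y)\<bar>)"
        using Phi(1) phi(1) by (intro member_le_sum) auto
      ultimately show ?thesis using phi(2) by linarith
    qed
    have "f x = 1" using V by blast
    then have "A \<le> J (\<lambda>y. norm (T f y))" by (rule J_lower[OF fC])
    also have "\<dots> \<le> J (\<lambda>y. norm (T f y - T f' y) + (\<Sum>\<phi>\<in>\<Phi>. \<bar>\<phi> (T f' y)\<bar>)) + A / 4"
      using A4 pw by (intro J_le_add_const C0_bcontfun C0_norm C0_add dC sC TfC) auto
    also have "J (\<lambda>y. norm (T f y - T f' y) + (\<Sum>\<phi>\<in>\<Phi>. \<bar>\<phi> (T f' y)\<bar>))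
        = J (\<lambda>y. norm (T f y - T f' y)) + (\<Sum>\<phi>\<in>\<Phi>. J (\<lambda>y. \<bar>\<phi> (T f' y)\<bar>))"
      by (simp only: J_add[OF C0_bcontfun[OF dC] C0_bcontfun[OF sC]] J_sum[of \<Phi> "\<lambda>\<phi> y. \<bar>\<phi> (T f' y)\<bar>", OF absC])
    also have "(\<Sum>\<phi>\<in>\<Phi>. J (\<lambda>y. \<bar>\<phi> (T f' y)\<bar>)) \<le> (\<Sum>\<phi>\<in>\<Phi>. e)"
    proof (intro sum_mono U(3) f'(1))
      show "\<bar>f' t\<bar> \<le> 1" for t using f'(2)[of t] by simp
      show "f' t = 0" if "\<phi> \<in> \<Phi>" "t \<notin> U \<phi>" for \<phi> t using that by (intro f'(3)) blast
    qed
    also have "\<dots> = A / 4" using card by (simp add: e_def)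
    finally show ?thesis by simp
  qed
  ultimately show ?thesis by blast
qed

lemma every_point_charged: "\<exists>y. \<exists>e>0. charges e y x"
proof (rule ccontr)
  assume "\<not> ?thesis"
  then have un: "\<And>y e. 0 < e \<Longrightarrow> \<not> charges e y x" by blast
  obtain J where J: "positive_functional J"
    and J_lower: "\<And>f. f \<in> C0 \<Longrightarrow> f x = 1 \<Longrightarrow> A \<le> J (\<lambda>y. norm (T f y))"
    using exists_positive_functional[of x] by blast
  have "\<exists>f. \<forall>n. peaking x (f n) \<and>
      ((\<forall>t. f (Suc n) t \<le> f n t) \<and> A / 2 \<le> J (\<lambda>y. norm (T (f n) y - T (f (Suc n)) y)))"
  proof (rule dependent_nat_choice)
    obtain f :: "'k \<Rightarrow> real" where "peaking x f"
      using C0_bump[OF locally_compact open_UNIV UNIV_I, of x] unfolding peaking_def by blast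
    then show "\<exists>f. peaking x f" by blast
  next
    fix f n assume "peaking x f"
    from uncharged_refine_peak[OF J J_lower un this]
    show "\<exists>f'. peaking x f' \<and> ((\<forall>t. f' t \<le> f t) \<and> A / 2 \<le> J (\<lambda>y. norm (T f y - T f' y)))" by blast
  qed
  then obtain f where f: "\<And>n. peaking x (f n)" "\<And>n t. f (Suc n) t \<le> f n t"
    "\<And>n. A / 2 \<le> J (\<lambda>y. norm (T (f n) y - T (f (Suc n)) y))" by blast
  have fC: "f n \<in> C0" and f01: "0 \<le> f n t" "f n t \<le> 1" for n t using f(1)[of n] by (auto simp: peaking_def)
  define d where "d n = (\<lambda>t. f n t - f (Suc n) t)" for n
  have dC: "d n \<in> C0" for n unfolding d_def by (intro C0_diff fC)
  have Td: "T (d n) = (\<lambda>y. T (f n) y - T (f (Suc n)) y)" for n unfolding d_def by (intro T_diff fC)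
  have d0: "0 \<le> d n t" for n t using f(2) by (simp add: d_def)
  \<comment> \<open>The differences are nonnegative and telescope to \<open>f 0 t - f m t\<close>,
    so \<open>T_null\<close> applies without disjoint supports.\<close>
  have sum: "(\<Sum>n\<in>S. \<bar>d n t\<bar>) \<le> 1" if "finite S" for S t
  proof -
    obtain m where m: "S \<subseteq> {..<m}" using \<open>finite S\<close> by (auto simp: finite_nat_set_iff_bounded)
    have "(\<Sum>n\<in>S. \<bar>d n t\<bar>) \<le> (\<Sum>n<m. \<bar>d n t\<bar>)" using m by (intro sum_mono2) auto
    also have "\<dots> = (\<Sum>n<m. f n t - f (Suc n) t)" using d0 by (simp add: d_def)
    also have "\<dots> = f 0 t - f m t" by (rule sum_lessThan_telescope')
    also have "\<dots> \<le> 1" using f01(2)[where n = 0 and t = t] f01(1)[where n = m and t = t] by simp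
    finally show ?thesis .
  qed
  interpret positive_functional J by (rule J)
  have "\<exists>n. J (\<lambda>y. norm (T (d n) y)) < A / 2"
  proof (rule bounded_convergence)
    show "(\<lambda>y. norm (T (d n) y)) \<in> C0" for n by (intro C0_norm T_C0 dC)
    show "norm (T (d n) y) \<le> B" for n y
    proof (rule norm_T_le[OF dC])
      show "\<bar>d n t\<bar> \<le> 1" for t using sum[of "{n}" t] by simp
    qed
    show "(\<lambda>n. norm (T (d n) y)) \<longlonglongrightarrow> 0" for y
      by (rule tendsto_norm_zero[OF T_null[OF dC sum]])
  qed (use A_pos in auto)
  then show False using f(3) by (simp add: Td not_less[symmetric])
qed

text \<open>The countable sets of points charged by each \<open>y\<close> cover \<open>'k\<close>,
  and an infinite cardinal absorbs a union of that many countable sets.\<close>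

lemma inj_of_infinite:
  includes cardinal_syntax
  assumes inf: "infinite (UNIV :: 'l set)"
  shows "\<exists>g :: 'k \<Rightarrow> 'l. inj g"
proof -
  have "|\<Union>y\<in>UNIV. {x. \<exists>e>0. charges e y x}| \<le>o |UNIV :: 'l set|"
  proof (rule card_of_UNION_ordLeq_infinite[OF inf])
    show "\<forall>y\<in>UNIV. |{x. \<exists>e>0. charges e y x}| \<le>o |UNIV :: 'l set|"
    proof
      fix y
      have "|{x. \<exists>e>0. charges e y x}| \<le>o |UNIV :: nat set|"
        using countable_charges[of y] unfolding countable_def card_of_ordLeq[symmetric] by auto
      also have "|UNIV :: nat set| \<le>o |UNIV :: 'l set|"
        using inf infinite_iff_card_of_nat by blast
      finally show "|{x. \<exists>e>0. charges e y x}| \<le>o |UNIV :: 'l set|" .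
    qed
  qed (simp add: card_of_refl ordIso_imp_ordLeq)
  moreover have "(\<Union>y\<in>UNIV. {x. \<exists>e>0. charges e y x}) = UNIV" using every_point_charged by blast
  ultimately have "|UNIV :: 'k set| \<le>o |UNIV :: 'l set|" by simp
  then show ?thesis unfolding card_of_ordLeq[symmetric] by blast
qed

end

theorem theorem1p1:
  fixes T :: "('k::t2_space \<Rightarrow> real) \<Rightarrow> ('l::t2_space \<Rightarrow> 'x::banach)"
  assumes "locally_compact_space (euclidean :: 'k topology)"
    and "locally_compact_space (euclidean :: 'l topology)"
    and "\<not> contains_copy_of_c0 TYPE('x)"
    and "separable_space (euclidean :: 'x topology) \<or> RNP TYPE('x \<Rightarrow>\<^sub>L real)"
    and "iso_embedding_into_fun_space (C0 :: ('k \<Rightarrow> real) set) (C0 :: ('l \<Rightarrow> 'x) set) T"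
  shows "finite (UNIV :: 'k set) \<or> (\<exists>g :: 'k \<Rightarrow> 'l. inj g)"
proof -
  obtain A B where AB: "0 < A" "0 < B"
    "\<And>f. f \<in> C0 \<Longrightarrow> A * supnorm f \<le> supnorm (T f)" "\<And>f. f \<in> C0 \<Longrightarrow> supnorm (T f) \<le> B * supnorm f"
    using assms(5) unfolding iso_embedding_into_fun_space_def by blast
  interpret C0_embedding T A B
    using assms(1,3,5) AB by unfold_locales (simp_all add: iso_embedding_into_fun_space_def)
  show ?thesis using finite_domain inj_of_infinite by blast
qed

end
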